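(* Let $n>2$ be a prime number, $\zeta\in\mathbb{C}$ a primitive $n$-th root of unity, and consider the family of polynomial systems with parameters $a$ described in the context. Let $I^{(n)}_R=\langle \zeta^{|\nu|}[\nu]-[\hat\nu] : \nu\in\mathcal{M}^{(n)}\rangle\subset\mathbb{C}[a]$, let $\mathsf{a}$ be the product of all $n\ell$ parameters, and let $I_\zeta=I^{(\zeta)}\cap\mathbb{C}[a]$. Then $$I^{(n)}_R:\mathsf{a}^\infty=I_\zeta .$$
   Context: $\mathbb{N}_0=\{0,1,2,\dots\}$ and $\mathbb{N}_{-1}=\mathbb{N}_0\cup\{-1\}$. $T_n$ is the cyclic permutation $T_n(p_1,\dots,p_n)=(p_n,p_1,\dots,p_{n-1})$, and $T_n^0$ is the identity. Fix $\ell\ge1$ and a set $S^{(n)}=\{\mathbf{p}^{(1)},\dots,\mathbf{p}^{(\ell)}\}\subset\mathbb{N}_{-1}\times\mathbb{N}_0^{n-1}$ of $\ell$ distinct vectors with $\sum_{j}p_j^{(k)}\ge1$ for all $k$. For a vector $\mathbf{p}$ write $\mathbf{x}^{\mathbf{p}}=x_1^{p_1}\cdots x_n^{p_n}$, and similarly $\alpha^{\mathbf{p}}$. The family of systems is $$\dot x_j=x_j\Big(\zeta^{j-1}+\sum_{k=1}^{\ell}a^{(j)}_{T_n^{j-1}(\mathbf{p}^{(k)})}\,\mathbf{x}^{T_n^{j-1}(\mathbf{p}^{(k)})}\Big),\qquad j=1,\dots,n,$$ with $n\ell$ independent complex parameters $a^{(j)}_{T_n^{j-1}(\mathbf{p}^{(k)})}$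 ($1\le j\le n$, $1\le k\le\ell$). $\mathbb{C}[a]$ is the polynomial ring in these parameters. For $\nu\in\mathbb{N}_0^{n\ell}$: $|\nu|=\nu_1+\dots+\nu_{n\ell}$; $[\nu]=\prod_{k=1}^{\ell}\prod_{m=0}^{n-1}\big(a^{(m+1)}_{T_n^m(\mathbf{p}^{(k)})}\big)^{\nu_{(k-1)n+m+1}}$; $L(\nu)=\sum_{k=1}^{\ell}\sum_{m=0}^{n-1}\nu_{(k-1)n+m+1}\,T_n^m(\mathbf{p}^{(k)})\in\mathbb{Z}^n$; $\hat\nu$ is obtained from $\nu$ by replacing, for each $k$, the block $(\nu_{(k-1)n+1},\dots,\nu_{kn})$ by $(\nu_{kn},\nu_{(k-1)n+1},\dots,\nu_{kn-1})$. $\mathcal{M}^{(n)}=\{\nu\in\mathbb{N}_0^{n\ell}: L(\nu)=(K,\dots,K)\text{ for some }K\in\mathbb{N}_0\}$. $I^{(\zeta)}$ is the ideal of $\mathbb{C}[\alpha_1^{\pm1},\dots,\alpha_n^{\pm1},a]$ generated by $1-\alpha_1\alpha_2\cdots\alpha_n$ and by all $\zeta\,a^{(i)}_{T_n^{i-1}(\mathbf{p}^{(k)})}\alpha^{T_n^{i-1}(\mathbf{p}^{(k)})}-a^{(i+1)}_{T_n^{i}(\mathbf{p}^{(k)})}$, $1\le i\le n$, $1\le k\le\ell$, where the upper index $n+1$ is read as $1$ (so for $i=n$ the last term is $a^{(1)}_{\mathbf{p}^{(k)}}$). For an ideal $I\subset\mathbb{C}[a]$, $I:\mathsf{a}^\infty=\{f\in\mathbb{C}[a]: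 \mathsf{a}^r f\in I\text{ for some }r\in\mathbb{N}_0\}$. *)

theory Defs
  imports
    Complex_Main
    "HOL-Computational_Algebra.Primes"
    "HOL-Algebra.Ideal"
    "HOL-Library.Poly_Mapping"
    "HOL-Library.Product_Plus"
begin

text \<open>
  Vectors and multi-indices are lists, so the coordinate written \<open>v\<^sub>j\<close> on paper, \<open>1 \<le> j \<le> n\<close>,
  is \<open>v ! (j - 1)\<close>.
\<close>

definition cyc :: "'a list \<Rightarrow> 'a list" where
  "cyc v = (if v = [] then [] else last v # butlast v)"

definition admissible :: "nat \<Rightarrow> nat \<Rightarrow> (nat \<Rightarrow> int list) \<Rightarrow> bool" where
  "admissible n l p \<longleftrightarrow>
     l \<ge> 1 \<and> inj_on p {1..l} \<and>
     (\<forall>k\<in>{1..l}. length (p k) = n \<and> p k ! 0 \<ge> -1 \<and> (\<forall>j\<in>{1..<n}. p k ! j \<ge> 0) \<and>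
        sum_list (p k) \<ge> 1)"

definition primitive_root_of_unity :: "nat \<Rightarrow> complex \<Rightarrow> bool" where
  "primitive_root_of_unity n z \<longleftrightarrow> n > 0 \<and> z ^ n = 1 \<and> (\<forall>k. 0 < k \<and> k < n \<longrightarrow> z ^ k \<noteq> 1)"

text \<open>
  All polynomials live in one monoid algebra over the complex numbers.  An exponent \<open>(u, e)\<close>
  consists of the integer exponents \<open>u\<close> of the Laurent variables \<open>\<alpha>\<^sub>j\<close> and the natural exponents
  \<open>e\<close> of the parameters.  The parameter indexed by \<open>(j, k)\<close> is the coefficient, in the \<open>j\<close>-th
  equation, of the monomial whose exponent vector is the \<open>(j - 1)\<close>-fold cyclic shift of \<open>p k\<close>.  As
  the vectors \<open>p k\<close> are distinct, \<open>(j, k)\<close> names it uniquely, and these are \<open>n * l\<close> independent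
  variables.  The polynomial ring in the parameters is literally a subring of the Laurent ring.
\<close>

type_synonym lpoly = "((nat \<Rightarrow>\<^sub>0 int) \<times> (nat \<times> nat \<Rightarrow>\<^sub>0 nat)) \<Rightarrow>\<^sub>0 complex"

definition ring_on :: "'a::comm_ring_1 set \<Rightarrow> 'a ring" where
  "ring_on A = \<lparr>carrier = A, mult = (*), one = 1, zero = 0, add = (+)\<rparr>"

definition laurent_ring :: "nat \<Rightarrow> nat \<Rightarrow> lpoly ring" where
  "laurent_ring n l = ring_on
     {f. \<forall>(u, e)\<in>Poly_Mapping.keys f.
           Poly_Mapping.keys u \<subseteq> {1..n} \<and> Poly_Mapping.keys e \<subseteq> {1..n} \<times> {1..l}}"

definition param_ring :: "nat \<Rightarrow> nat \<Rightarrow> lpoly ring" where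
  "param_ring n l = ring_on
     {f. \<forall>(u, e)\<in>Poly_Mapping.keys f.
           u = 0 \<and> Poly_Mapping.keys e \<subseteq> {1..n} \<times> {1..l}}"

definition const :: "complex \<Rightarrow> lpoly" where
  "const c = Poly_Mapping.single 0 c"

definition par :: "nat \<Rightarrow> nat \<Rightarrow> lpoly" where
  "par j k = Poly_Mapping.single (0, Poly_Mapping.single (j, k) 1) 1"

definition alpha :: "nat \<Rightarrow> lpoly" where
  "alpha j = Poly_Mapping.single (Poly_Mapping.single j 1, 0) 1"

(* the Laurent monomial alpha_1^(v_1) * ... * alpha_n^(v_n), with possibly negative exponents *)
definition alpha_pow :: "int list \<Rightarrow> lpoly" where
  "alpha_pow v =
     Poly_Mapping.single (\<Sum>j=1..length v. Poly_Mapping.single j (v ! (j - 1)), 0) 1"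

definition par_prod :: "nat \<Rightarrow> nat \<Rightarrow> lpoly" where
  "par_prod n l = (\<Prod>j=1..n. \<Prod>k=1..l. par j k)"

definition nu_monom :: "nat \<Rightarrow> nat \<Rightarrow> nat list \<Rightarrow> lpoly" where
  "nu_monom n l \<nu> = (\<Prod>k=1..l. \<Prod>m=0..<n. par (m + 1) k ^ (\<nu> ! ((k - 1) * n + m)))"

definition L_map :: "nat \<Rightarrow> nat \<Rightarrow> (nat \<Rightarrow> int list) \<Rightarrow> nat list \<Rightarrow> int list" where
  "L_map n l p \<nu> =
     map (\<lambda>i. \<Sum>k=1..l. \<Sum>m=0..<n. int (\<nu> ! ((k - 1) * n + m)) * ((cyc ^^ m) (p k) ! i)) [0..<n]"

definition hat :: "nat \<Rightarrow> nat \<Rightarrow> nat list \<Rightarrow> nat list" where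
  "hat n l \<nu> = concat (map (\<lambda>k. cyc (take n (drop (k * n) \<nu>))) [0..<l])"

definition M_set :: "nat \<Rightarrow> nat \<Rightarrow> (nat \<Rightarrow> int list) \<Rightarrow> nat list set" where
  "M_set n l p = {\<nu>. length \<nu> = n * l \<and> (\<exists>K::nat. L_map n l p \<nu> = replicate n (int K))}"

definition I_R :: "nat \<Rightarrow> nat \<Rightarrow> (nat \<Rightarrow> int list) \<Rightarrow> complex \<Rightarrow> lpoly set" where
  "I_R n l p \<zeta> = Idl\<^bsub>param_ring n l\<^esub>
     {const (\<zeta> ^ sum_list \<nu>) * nu_monom n l \<nu> - nu_monom n l (hat n l \<nu>) | \<nu>. \<nu> \<in> M_set n l p}"

(* i mod n + 1 is the successor of i in {1..n}, with n + 1 read as 1 *)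
definition I_laurent :: "nat \<Rightarrow> nat \<Rightarrow> (nat \<Rightarrow> int list) \<Rightarrow> complex \<Rightarrow> lpoly set" where
  "I_laurent n l p \<zeta> = Idl\<^bsub>laurent_ring n l\<^esub>
     ({1 - (\<Prod>j=1..n. alpha j)} \<union>
      {const \<zeta> * par i k * alpha_pow ((cyc ^^ (i - 1)) (p k)) - par (i mod n + 1) k | i k.
         i \<in> {1..n} \<and> k \<in> {1..l}})"

definition I_zeta :: "nat \<Rightarrow> nat \<Rightarrow> (nat \<Rightarrow> int list) \<Rightarrow> complex \<Rightarrow> lpoly set" where
  "I_zeta n l p \<zeta> = I_laurent n l p \<zeta> \<inter> carrier (param_ring n l)"

definition saturation :: "nat \<Rightarrow> nat \<Rightarrow> lpoly set \<Rightarrow> lpoly set" where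
  "saturation n l I = {f \<in> carrier (param_ring n l). \<exists>r::nat. par_prod n l ^ r * f \<in> I}"

text \<open>
  \<open>genideal\<close> is an intersection of ideals, hence meaningful only over an actual ring; this is
  checked here for both carriers.
\<close>

lemma cring_ring_on:
  fixes A :: "'a::comm_ring_1 set"
  assumes "0 \<in> A" "1 \<in> A"
    and add: "\<And>x y. x \<in> A \<Longrightarrow> y \<in> A \<Longrightarrow> x + y \<in> A"
    and mul: "\<And>x y. x \<in> A \<Longrightarrow> y \<in> A \<Longrightarrow> x * y \<in> A"
    and neg: "\<And>x. x \<in> A \<Longrightarrow> - x \<in> A"
  shows "cring (ring_on A)"
proof (rule cringI)
  show "abelian_group (ring_on A)"
  proof (rule abelian_groupI)
    fix x assume "x \<in> carrier (ring_on A)"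
    then show "\<exists>y\<in>carrier (ring_on A). y \<oplus>\<^bsub>ring_on A\<^esub> x = \<zero>\<^bsub>ring_on A\<^esub>"
      using neg by (intro bexI[of _ "- x"]) (simp_all add: ring_on_def)
  qed (simp_all add: ring_on_def assms add.assoc add.commute)
  show "Group.comm_monoid (ring_on A)"
    by (rule comm_monoidI) (simp_all add: ring_on_def assms mult.assoc mult.commute)
qed (simp add: ring_on_def distrib_right)

lemma in_keys_mult:
  fixes f g :: "('a::monoid_add) \<Rightarrow>\<^sub>0 ('b::semiring_0)"
  assumes "x \<in> Poly_Mapping.keys (f * g)"
  obtains a b where "a \<in> Poly_Mapping.keys f" "b \<in> Poly_Mapping.keys g" "x = a + b"
  using assms keys_mult[of f g] by auto

lemma cring_supported:
  fixes E :: "((nat \<Rightarrow>\<^sub>0 int) \<times> (nat \<times> nat \<Rightarrow>\<^sub>0 nat)) set"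
  assumes "0 \<in> E" and "\<And>x y. x \<in> E \<Longrightarrow> y \<in> E \<Longrightarrow> x + y \<in> E"
  shows "cring (ring_on {f :: lpoly. Poly_Mapping.keys f \<subseteq> E})"
proof (rule cring_ring_on, goal_cases)
  case 2 show ?case using assms(1) by auto
next
  case (3 x y) then show ?case using Poly_Mapping.keys_add[of x y] by auto
next
  case (4 x y)
  show ?case
  proof (rule CollectI, rule subsetI)
    fix c assume "c \<in> Poly_Mapping.keys (x * y)"
    then obtain a b where "a \<in> Poly_Mapping.keys x" "b \<in> Poly_Mapping.keys y" "c = a + b"
      by (rule in_keys_mult)
    with 4 show "c \<in> E" using assms(2) by blast
  qed
qed auto

lemma keys_add_subset:
  "Poly_Mapping.keys x \<subseteq> A \<Longrightarrow> Poly_Mapping.keys y \<subseteq> A \<Longrightarrow> Poly_Mapping.keys (x + y) \<subseteq> A"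
  by (rule order_trans[OF Poly_Mapping.keys_add Un_least])

lemma cring_laurent_ring: "cring (laurent_ring n l)"
proof -
  let ?E = "{(u, e). Poly_Mapping.keys (u :: nat \<Rightarrow>\<^sub>0 int) \<subseteq> {1..n} \<and>
               Poly_Mapping.keys (e :: nat \<times> nat \<Rightarrow>\<^sub>0 nat) \<subseteq> {1..n} \<times> {1..l}}"
  have "cring (ring_on {f :: lpoly. Poly_Mapping.keys f \<subseteq> ?E})"
  proof (rule cring_supported, goal_cases)
    case (2 x y)
    then show ?case
      by (cases x; cases y) (simp add: keys_add_subset)
  qed (auto simp: zero_prod_def)
  also have "{f :: lpoly. Poly_Mapping.keys f \<subseteq> ?E} = {f. \<forall>(u, e)\<in>Poly_Mapping.keys f.
      Poly_Mapping.keys u \<subseteq> {1..n} \<and> Poly_Mapping.keys e \<subseteq> {1..n} \<times> {1..l}}"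
    by blast
  finally show ?thesis by (simp add: laurent_ring_def)
qed

lemma cring_param_ring: "cring (param_ring n l)"
proof -
  let ?E = "{(u, e). (u :: nat \<Rightarrow>\<^sub>0 int) = 0 \<and>
               Poly_Mapping.keys (e :: nat \<times> nat \<Rightarrow>\<^sub>0 nat) \<subseteq> {1..n} \<times> {1..l}}"
  have "cring (ring_on {f :: lpoly. Poly_Mapping.keys f \<subseteq> ?E})"
  proof (rule cring_supported, goal_cases)
    case (2 x y)
    then show ?case
      by (cases x; cases y) (simp add: keys_add_subset)
  qed (auto simp: zero_prod_def)
  also have "{f :: lpoly. Poly_Mapping.keys f \<subseteq> ?E} = {f. \<forall>(u, e)\<in>Poly_Mapping.keys f.
      u = 0 \<and> Poly_Mapping.keys e \<subseteq> {1..n} \<times> {1..l}}"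
    by blast
  finally show ?thesis by (simp add: param_ring_def)
qed

end

theory Submission
  imports Defs
begin

text \<open>
  Both sides are the set of polynomials in the parameters that vanish under one ring homomorphism,
  the normal form.

  Modulo the Laurent ideal the parameters satisfy a recursion: the one with index \<open>(i + 1, k)\<close> is
  \<open>\<zeta>\<close> times the one with index \<open>(i, k)\<close> times \<open>\<alpha>\<close> to the power \<open>T\<^sup>i\<^sup>-\<^sup>1 (p k)\<close>.  Hence every
  parameter is congruent to \<open>\<zeta>\<^sup>i\<^sup>-\<^sup>1 \<alpha>\<^sup>s\<close> times the parameter \<open>(1, k)\<close>, where \<open>s\<close> is the sum of the first
  \<open>i - 1\<close> cyclic shifts of \<open>p k\<close>, and the relation \<open>\<alpha>\<^sub>1 \<cdots> \<alpha>\<^sub>n = 1\<close> makes \<open>\<alpha>\<^sub>n\<close> redundant.  Going once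
  around the cycle gives no new relation, because all \<open>n\<close> shifts of \<open>p k\<close> add up to a constant vector
  and \<open>\<zeta>\<^sup>n = 1\<close>.  Carrying out these substitutions sends each monomial to a nonzero multiple of a
  monomial (\<open>nf_exp\<close>, \<open>nf_coeff\<close>); the resulting homomorphism kills the generators of the Laurent ideal
  and changes every Laurent polynomial by an element of that ideal only, so its kernel is exactly the
  Laurent ideal (\<open>normal_form_I_laurent\<close>, \<open>kernel_subset_I_laurent\<close>).

  It remains to identify the polynomials in the kernel with the saturation.  One inclusion holds since
  the generators \<open>\<zeta>\<^sup>|\<^sup>\<nu>\<^sup>| [\<nu>] - [\<nu>']\<close>, with \<open>\<nu>'\<close> the shifted multi-index, are in the kernel
  (\<open>nf_shift\<close>), and a product of parameters is not a zero divisor modulo the kernel.  For the other,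
  the kernel of a map sending monomials to multiples of monomials is spanned by binomials
  (\<open>relabel_kernel_binomials\<close>), so it suffices to treat two multi-indices \<open>e\<close> and \<open>d\<close> with the same
  normal form.  They have equal block sums, hence \<open>d - e = \<nu>' - \<nu>\<close> for some \<open>\<nu>\<close>, which is unique up to
  adding a constant to each block.  Equality of the \<open>\<alpha>\<close>-exponents says, by summation by parts, that
  \<open>L(\<nu>)\<close> is a constant vector, and adding a large constant to \<open>\<nu>\<close> makes \<open>\<nu>\<close> and that constant
  nonnegative, because every \<open>p k\<close> has positive coordinate sum (\<open>cyclic_difference\<close>).  Thus a monomial
  multiple of the binomial is a monomial multiple of the single generator given by \<open>\<nu>\<close>
  (\<open>binomial_in_saturation\<close>).
\<close>

section \<open>Maps between monoid algebras induced by exponent maps\<close>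

text \<open>
  The map of monoid algebras sending the monomial with exponent \<open>x\<close> to \<open>\<chi> x\<close> times the one with
  exponent \<open>h x\<close>.  It is additive for arbitrary \<open>h\<close> and \<open>\<chi>\<close>, and a ring homomorphism when both respect
  the monoid structure.
\<close>

definition relabel :: "('a \<Rightarrow> 'b) \<Rightarrow> ('a \<Rightarrow> 'c) \<Rightarrow> ('a \<Rightarrow>\<^sub>0 'c) \<Rightarrow> ('b \<Rightarrow>\<^sub>0 'c::comm_semiring_1)" where
  "relabel h \<chi> f = (\<Sum>x\<in>Poly_Mapping.keys f. Poly_Mapping.single (h x) (\<chi> x * Poly_Mapping.lookup f x))"

lemma relabel_superset:
  assumes "finite A" "Poly_Mapping.keys f \<subseteq> A"
  shows "relabel h \<chi> f = (\<Sum>x\<in>A. Poly_Mapping.single (h x) (\<chi> x * Poly_Mapping.lookup f x))"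
  unfolding relabel_def
  by (rule sum.mono_neutral_left) (use assms in \<open>auto simp: in_keys_iff\<close>)

lemma relabel_zero [simp]: "relabel h \<chi> 0 = 0"
  by (simp add: relabel_def)

lemma relabel_single [simp]:
  "relabel h \<chi> (Poly_Mapping.single x c) = Poly_Mapping.single (h x) (\<chi> x * c)"
  by (subst relabel_superset[of "{x}"]) auto

lemma relabel_add: "relabel h \<chi> (f + g) = relabel h \<chi> f + relabel h \<chi> g"
proof -
  let ?A = "Poly_Mapping.keys f \<union> Poly_Mapping.keys g"
  have "relabel h \<chi> (f + g) = (\<Sum>x\<in>?A. Poly_Mapping.single (h x) (\<chi> x * Poly_Mapping.lookup (f + g) x))"
    by (rule relabel_superset) (auto simp: Poly_Mapping.keys_add)
  also have "\<dots> = relabel h \<chi> f + relabel h \<chi> g"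
    by (simp add: relabel_superset[of ?A f] relabel_superset[of ?A g] lookup_add distrib_left
        single_add sum.distrib)
  finally show ?thesis .
qed

lemma relabel_sum: "relabel h \<chi> (\<Sum>x\<in>A. f x) = (\<Sum>x\<in>A. relabel h \<chi> (f x))"
  by (induction A rule: infinite_finite_induct) (auto simp: relabel_add)

lemma relabel_diff:
  fixes f g :: "'a \<Rightarrow>\<^sub>0 'c::comm_ring_1"
  shows "relabel h \<chi> (f - g) = relabel h \<chi> f - relabel h \<chi> g"
  using relabel_add[of h \<chi> "f - g" g] by (simp add: algebra_simps)

lemma sum_monomials: "(\<Sum>x\<in>Poly_Mapping.keys f. Poly_Mapping.single x (Poly_Mapping.lookup f x)) = f"
  by (rule poly_mapping_eqI) (auto simp: lookup_sum lookup_single when_def in_keys_iff)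

lemma relabel_mult:
  fixes f g :: "'a::monoid_add \<Rightarrow>\<^sub>0 'c::comm_ring_1" and h :: "'a \<Rightarrow> 'b::monoid_add"
  assumes h: "\<And>x y. h (x + y) = h x + h y" and \<chi>: "\<And>x y. \<chi> (x + y) = \<chi> x * \<chi> y"
  shows "relabel h \<chi> (f * g) = relabel h \<chi> f * relabel h \<chi> g"
proof -
  let ?s = "Poly_Mapping.single"
  have "relabel h \<chi> (f * g) = relabel h \<chi> ((\<Sum>x\<in>Poly_Mapping.keys f. ?s x (Poly_Mapping.lookup f x)) *
      (\<Sum>y\<in>Poly_Mapping.keys g. ?s y (Poly_Mapping.lookup g y)))"
    by (simp only: sum_monomials)
  also have "\<dots> = (\<Sum>x\<in>Poly_Mapping.keys f. \<Sum>y\<in>Poly_Mapping.keys g.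
      ?s (h x) (\<chi> x * Poly_Mapping.lookup f x) * ?s (h y) (\<chi> y * Poly_Mapping.lookup g y))"
    by (simp add: sum_distrib_left sum_distrib_right mult_single relabel_sum h \<chi> mult_ac
        sum.swap[of _ "Poly_Mapping.keys g"])
  also have "\<dots> = relabel h \<chi> f * relabel h \<chi> g"
    by (simp add: relabel_def sum_product)
  finally show ?thesis .
qed

text \<open>
  The kernel is spanned by the binomials supported on a single fibre of \<open>h\<close>: subtracting such binomials
  moves all terms of a fibre onto one representative, whose total coefficient is, up to a nonzero
  factor, a coefficient of the image.  \<open>J\<close> stands for any additive set that contains these
  binomials.
\<close>

lemma relabel_kernel_binomials:
  fixes f :: "'a \<Rightarrow>\<^sub>0 'c::field"
  assumes ker: "relabel h \<chi> f = 0"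
    and \<chi>: "\<And>x. \<chi> x \<noteq> 0"
    and J0: "0 \<in> J" and Jadd: "\<And>g g'. g \<in> J \<Longrightarrow> g' \<in> J \<Longrightarrow> g + g' \<in> J"
    and J: "\<And>x y c. x \<in> Poly_Mapping.keys f \<Longrightarrow> y \<in> Poly_Mapping.keys f \<Longrightarrow> h x = h y \<Longrightarrow>
        Poly_Mapping.single x (c * \<chi> y) - Poly_Mapping.single y (c * \<chi> x) \<in> J"
  shows "f \<in> J"
proof -
  let ?s = "Poly_Mapping.single" and ?K = "Poly_Mapping.keys f"
  define r where "r z = (SOME x. x \<in> ?K \<and> h x = z)" for z
  have r: "r (h x) \<in> ?K" "h (r (h x)) = h x" if "x \<in> ?K" for x
  proof -
    have "r (h x) \<in> ?K \<and> h (r (h x)) = h x"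
      unfolding r_def by (rule someI[of _ x]) (use that in simp)
    then show "r (h x) \<in> ?K" "h (r (h x)) = h x" by auto
  qed
  (* Applying the section r to the image collects the terms of each fibre of h on its representative;
     as the image is 0, so is the collected sum. *)
  have "relabel r (\<lambda>z. inverse (\<chi> (r z))) (relabel h \<chi> f) = 0"
    by (simp add: ker)
  then have 0: "(\<Sum>x\<in>?K. ?s (r (h x)) (inverse (\<chi> (r (h x))) * (\<chi> x * Poly_Mapping.lookup f x))) = 0"
    by (simp add: relabel_def[of h] relabel_sum)
  have collect: "(\<Sum>x\<in>?K. ?s x (Poly_Mapping.lookup f x) -
      ?s (r (h x)) (inverse (\<chi> (r (h x))) * (\<chi> x * Poly_Mapping.lookup f x))) = f"
    by (simp only: sum_subtractf 0 sum_monomials diff_0_right)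
  have "(\<Sum>x\<in>A. ?s x (Poly_Mapping.lookup f x) -
      ?s (r (h x)) (inverse (\<chi> (r (h x))) * (\<chi> x * Poly_Mapping.lookup f x))) \<in> J" if "A \<subseteq> ?K" for A
    using finite_subset[OF that finite_keys] that
  proof (induction A rule: finite_induct)
    case (insert x A)
    define c where "c = Poly_Mapping.lookup f x * inverse (\<chi> (r (h x)))"
    have "?s x (c * \<chi> (r (h x))) - ?s (r (h x)) (c * \<chi> x) \<in> J"
      by (rule J) (use insert.prems r in auto)
    moreover have "c * \<chi> (r (h x)) = Poly_Mapping.lookup f x"
      using \<chi> by (simp add: c_def mult.assoc)
    moreover have "c * \<chi> x = inverse (\<chi> (r (h x))) * (\<chi> x * Poly_Mapping.lookup f x)"
      by (simp add: c_def mult_ac)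
    ultimately have "?s x (Poly_Mapping.lookup f x) -
        ?s (r (h x)) (inverse (\<chi> (r (h x))) * (\<chi> x * Poly_Mapping.lookup f x)) \<in> J"
      by (simp only:)
    then show ?case
      using Jadd[OF _ insert.IH] insert.prems insert.hyps by simp
  qed (simp add: J0)
  from this[OF subset_refl] show ?thesis by (simp only: collect)
qed

text \<open>
  Multiplication by a monomial relabels exponents injectively, so the fibres are singletons and the
  binomials spanning the kernel are all zero.
\<close>

lemma single_mult_eq_0D:
  fixes f :: "'a::cancel_comm_monoid_add \<Rightarrow>\<^sub>0 'c::field"
  assumes "Poly_Mapping.single y c * f = 0" "c \<noteq> 0"
  shows "f = 0"
proof -
  have "relabel ((+) y) (\<lambda>_. c) f = Poly_Mapping.single y c *
      (\<Sum>x\<in>Poly_Mapping.keys f. Poly_Mapping.single x (Poly_Mapping.lookup f x))"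
    by (simp add: relabel_def sum_distrib_left mult_single)
  then have "relabel ((+) y) (\<lambda>_. c) f = 0"
    using assms(1) by (simp add: sum_monomials)
  then have "f \<in> {0}"
    by (rule relabel_kernel_binomials) (use assms(2) in auto)
  then show ?thesis by simp
qed

lemma lookup_sum_single:
  assumes "finite A"
  shows "Poly_Mapping.lookup (\<Sum>j\<in>A. Poly_Mapping.single j (c j)) i = (if i \<in> A then c i else 0)"
  using assms by (simp add: lookup_sum lookup_single when_def)

section \<open>Ideals of a subring\<close>

text \<open>
  A dictionary between ideals of a subring \<open>A\<close> of a type, taken in the ring structure \<open>ring_on A\<close>, and
  the arithmetic operations of the type itself.
\<close>

locale generated_ideal =
  fixes A S :: "'a::comm_ring_1 set"
  assumes cring: "cring (ring_on A)" and gens: "S \<subseteq> A"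
begin

lemma carrier_closed:
  shows "0 \<in> A" "1 \<in> A" "x \<in> A \<Longrightarrow> y \<in> A \<Longrightarrow> x + y \<in> A" "x \<in> A \<Longrightarrow> y \<in> A \<Longrightarrow> x * y \<in> A"
  using cring.cring_simprules[OF cring] by (simp_all add: ring_on_def)

lemma a_inv_eq:
  assumes "x \<in> A" shows "a_inv (ring_on A) x = - x" "- x \<in> A"
proof -
  have "a_inv (ring_on A) x \<in> A" "a_inv (ring_on A) x + x = 0"
    using cring.cring_simprules(3,9)[OF cring, of x] assms by (simp_all add: ring_on_def)
  then show "a_inv (ring_on A) x = - x" "- x \<in> A"
    by (auto simp: add_eq_0_iff2)
qed

lemma ideal_Idl: "ideal (Idl\<^bsub>ring_on A\<^esub> S) (ring_on A)"
  using ring.genideal_ideal[of "ring_on A" S] cring gens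
  by (simp add: cring.axioms(1) ring_on_def)

lemma Idl_generator: "x \<in> S \<Longrightarrow> x \<in> Idl\<^bsub>ring_on A\<^esub> S"
  using ring.genideal_self[of "ring_on A" S] cring gens
  by (auto simp: cring.axioms(1) ring_on_def)

lemma Idl_0: "0 \<in> Idl\<^bsub>ring_on A\<^esub> S"
  using additive_subgroup.zero_closed[OF ideal.axioms(1)[OF ideal_Idl]] by (simp add: ring_on_def)

lemma Idl_add: "x \<in> Idl\<^bsub>ring_on A\<^esub> S \<Longrightarrow> y \<in> Idl\<^bsub>ring_on A\<^esub> S \<Longrightarrow> x + y \<in> Idl\<^bsub>ring_on A\<^esub> S"
  using additive_subgroup.a_closed[OF ideal.axioms(1)[OF ideal_Idl]] by (simp add: ring_on_def)

lemma Idl_mult: "x \<in> Idl\<^bsub>ring_on A\<^esub> S \<Longrightarrow> y \<in> A \<Longrightarrow> y * x \<in> Idl\<^bsub>ring_on A\<^esub> S"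
  using ideal.I_l_closed[OF ideal_Idl] by (simp add: ring_on_def)

lemma Idl_uminus: "x \<in> Idl\<^bsub>ring_on A\<^esub> S \<Longrightarrow> - x \<in> Idl\<^bsub>ring_on A\<^esub> S"
  using Idl_mult[of x "- 1"] a_inv_eq(2)[of 1] carrier_closed by simp

lemma Idl_sum: "(\<And>i. i \<in> I \<Longrightarrow> f i \<in> Idl\<^bsub>ring_on A\<^esub> S) \<Longrightarrow> sum f I \<in> Idl\<^bsub>ring_on A\<^esub> S"
  by (induction I rule: infinite_finite_induct) (auto simp: Idl_0 Idl_add)

lemma Idl_minimal:
  assumes "S \<subseteq> Z" "0 \<in> Z" "\<And>x y. x \<in> Z \<Longrightarrow> y \<in> Z \<Longrightarrow> x + y \<in> Z"
    and mult: "\<And>x y. x \<in> A \<Longrightarrow> y \<in> Z \<Longrightarrow> x * y \<in> Z"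
  shows "Idl\<^bsub>ring_on A\<^esub> S \<subseteq> Z"
proof -
  have "ideal (A \<inter> Z) (ring_on A)"
  proof (rule idealI)
    show "ring (ring_on A)" by (rule cring.axioms(1)[OF cring])
    have neg: "- x \<in> A \<inter> Z" if "x \<in> A \<inter> Z" for x
      using mult[of "- 1" x] a_inv_eq(2) carrier_closed that by simp
    have inv: "inv\<^bsub>add_monoid (ring_on A)\<^esub> x = - x" if "x \<in> A" for x
      using a_inv_eq(1)[OF that] by (simp add: a_inv_def)
    show "subgroup (A \<inter> Z) (add_monoid (ring_on A))"
    proof (rule subgroup.intro, goal_cases)
      case (4 x) then show ?case using neg[of x] inv[of x] by simp
    qed (use assms carrier_closed in \<open>auto simp: ring_on_def\<close>)
  next
    show "a \<otimes>\<^bsub>ring_on A\<^esub> x \<in> A \<inter> Z" "x \<otimes>\<^bsub>ring_on A\<^esub> a \<in> A \<inter> Z"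
      if "a \<in> A \<inter> Z" "x \<in> carrier (ring_on A)" for a x
    proof -
      have "x * a \<in> A \<inter> Z" using that mult[of x a] carrier_closed(4)[of x a] by (simp add: ring_on_def)
      then show "a \<otimes>\<^bsub>ring_on A\<^esub> x \<in> A \<inter> Z" "x \<otimes>\<^bsub>ring_on A\<^esub> a \<in> A \<inter> Z"
        unfolding mult.commute[of a x] by (simp_all add: ring_on_def mult.commute[of a x])
    qed
  qed
  moreover have "S \<subseteq> A \<inter> Z" using gens assms(1) by auto
  ultimately show ?thesis
    using ring.genideal_minimal[OF cring.axioms(1)[OF cring]] by blast
qed

end

section \<open>The parameters and their cyclic shift\<close>

locale cyclic_family =
  fixes n l :: nat and p :: "nat \<Rightarrow> int list" and \<zeta> :: complex
  assumes n_pos: "0 < n" and l_pos: "0 < l" and root: "\<zeta> ^ n = 1"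
    and len: "\<And>k. k \<in> {1..l} \<Longrightarrow> length (p k) = n"
    and deg: "\<And>k. k \<in> {1..l} \<Longrightarrow> sum_list (p k) \<ge> 1"
begin

text \<open>
  Multi-indices are handled as functions of the index pair \<open>(i, k)\<close> of a parameter; \<open>shift\<close> is the
  block-wise cyclic shift of \<open>hat\<close> in this form.
\<close>

definition shift :: "(nat \<times> nat \<Rightarrow> 'a) \<Rightarrow> nat \<times> nat \<Rightarrow> 'a" where
  "shift f = (\<lambda>(i, k). f (if i = 1 then n else i - 1, k))"

definition total :: "(nat \<times> nat \<Rightarrow> nat) \<Rightarrow> nat" where
  "total f = (\<Sum>k=1..l. \<Sum>i=1..n. f (i, k))"

definition L_coord :: "(nat \<times> nat \<Rightarrow> nat) \<Rightarrow> nat \<Rightarrow> int" where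
  "L_coord f j = (\<Sum>k=1..l. \<Sum>i=1..n. int (f (i, k)) * ((cyc ^^ (i - 1)) (p k) ! (j - 1)))"

text \<open>
  Coordinate \<open>j\<close> of the \<open>\<alpha>\<close>-exponent that is collected in passing from the parameter \<open>(1, k)\<close> to the
  parameter \<open>(i + 1, k)\<close>.
\<close>

definition shift_sum :: "nat \<Rightarrow> nat \<Rightarrow> nat \<Rightarrow> int" where
  "shift_sum i k j = (\<Sum>m<i. (cyc ^^ m) (p k) ! (j - 1))"

text \<open>
  The \<open>\<alpha>\<close>-exponent and, below, the exponent of \<open>\<zeta>\<close> that a monomial acquires when all of its parameters
  are expressed through those with first index \<open>1\<close>.
\<close>

definition alpha_exp :: "(nat \<times> nat \<Rightarrow> nat) \<Rightarrow> nat \<Rightarrow> int" where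
  "alpha_exp f j = (\<Sum>k=1..l. \<Sum>i=1..n. int (f (i, k)) * shift_sum (i - 1) k j)"

definition zeta_exp :: "(nat \<times> nat \<Rightarrow> nat) \<Rightarrow> nat" where
  "zeta_exp f = (\<Sum>k=1..l. \<Sum>i=1..n. f (i, k) * (i - 1))"

definition exponent :: "(nat \<times> nat \<Rightarrow> nat) \<Rightarrow> nat \<times> nat \<Rightarrow>\<^sub>0 nat" where
  "exponent f = (\<Sum>k=1..l. \<Sum>i=1..n. Poly_Mapping.single (i, k) (f (i, k)))"

text \<open>
  A cyclic shift of \<open>a\<close> against \<open>s\<close> trades \<open>s (i - 1)\<close> for \<open>s i\<close>; the boundary term at \<open>m\<close> is what the
  cyclic shift adds to ordinary Abel summation when \<open>N = m\<close>.  The wrapped-around index is a separate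
  variable \<open>N\<close>, which stays fixed in the induction on \<open>m\<close>; its term vanishes by \<open>s 0 = 0\<close>.
\<close>

lemma summation_by_parts:
  fixes a s :: "nat \<Rightarrow> 'a::comm_semiring_1"
  assumes "s 0 = 0" "0 < m"
  shows "(\<Sum>i=1..m. a (if i = 1 then N else i - 1) * s (i - 1)) + a m * s m = (\<Sum>i=1..m. a i * s i)"
  using assms(2)
proof (induction m)
  case (Suc m)
  then show ?case
    by (cases "m = 0") (simp_all add: assms(1) add_ac)
qed simp

lemma shift_column_sum:
  "(\<Sum>i=1..n. shift f (i, k)) = (\<Sum>i=1..n. f (i, k))" for f :: "nat \<times> nat \<Rightarrow> nat"
proof -
  have "(\<Sum>i=1..m. f (if i = 1 then N else i - 1, k)) + f (m, k) = f (N, k) + (\<Sum>i=1..m. f (i, k))"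
    if "0 < m" for m N
    using that
  proof (induction m)
    case (Suc m)
    then show ?case
      by (cases "m = 0") simp_all
  qed simp
  from this[OF n_pos, of n] show ?thesis by (simp add: shift_def)
qed

lemma nth_cyc: "v \<noteq> [] \<Longrightarrow> j < length v \<Longrightarrow> cyc v ! j = v ! ((j + (length v - 1)) mod length v)"
  by (cases j) (auto simp: cyc_def last_conv_nth nth_butlast)

lemma length_cyc [simp]: "length (cyc v) = length v"
  by (simp add: cyc_def)

lemma length_cyc_pow [simp]: "length ((cyc ^^ m) v) = length v"
  by (induction m) auto

lemma nth_cyc_pow:
  assumes "j < length v"
  shows "(cyc ^^ m) v ! j = v ! ((j + m * (length v - 1)) mod length v)"
  using assms
proof (induction m arbitrary: j)
  case (Suc m)
  have "(cyc ^^ Suc m) v ! j = (cyc ^^ m) v ! ((j + (length v - 1)) mod length v)"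
    using Suc.prems nth_cyc[of "(cyc ^^ m) v" j] by (metis length_cyc_pow funpow.simps(2) comp_apply list.size(3) not_less0)
  also have "\<dots> = v ! (((j + (length v - 1)) mod length v + m * (length v - 1)) mod length v)"
    by (rule Suc.IH, rule mod_less_divisor) (use Suc.prems in linarith)
  also have "((j + (length v - 1)) mod length v + m * (length v - 1)) mod length v =
      (j + Suc m * (length v - 1)) mod length v"
    by (simp only: mod_add_left_eq mult_Suc add.assoc)
  finally show ?case .
qed simp

text \<open>
  Over a full cycle every entry visits every position once.
\<close>

lemma sum_cyc_pow:
  assumes "j < length v"
  shows "(\<Sum>m<length v. (cyc ^^ m) v ! j) = sum_list (v :: int list)"
proof -
  let ?g = "\<lambda>m. (j + m * (length v - 1)) mod length v"
  (* The index map m |-> j - m modulo the length is an involution. *)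
  have invol: "?g (?g m) = m" if "m < length v" for m
  proof -
    obtain q where q: "length v = Suc q" using assms by (cases "length v") auto
    show ?thesis
    proof (cases q)
      case 0 then show ?thesis using that q by simp
    next
      case (Suc r)
      have "?g (?g m) = (j + (j + m * q) * q) mod Suc q"
        unfolding q diff_Suc_1 by (metis mod_add_right_eq mod_mult_left_eq)
      also have "j + (j + m * q) * q = m + (j + m * r) * Suc q"
        by (simp add: Suc algebra_simps)
      also have "\<dots> mod Suc q = m"
        using that q by (simp only: mod_mult_self1 mod_less)
      finally show ?thesis .
    qed
  qed
  have "(\<Sum>m<length v. v ! ?g m) = (\<Sum>m<length v. v ! m)"
    by (rule sum.reindex_bij_witness[where i = ?g and j = ?g]) (use invol assms in \<open>auto simp: mod_less_divisor[OF order.strict_trans1[OF le0 assms]]\<close>)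
  then show ?thesis
    using assms by (simp add: nth_cyc_pow sum_list_sum_nth atLeast0LessThan)
qed

lemma shift_sum_n: "k \<in> {1..l} \<Longrightarrow> j \<in> {1..n} \<Longrightarrow> shift_sum n k j = sum_list (p k)"
  using sum_cyc_pow[of "j - 1" "p k"] len[of k] by (auto simp: shift_sum_def)

lemma shift_sum_Suc: "0 < i \<Longrightarrow> shift_sum i k j = shift_sum (i - 1) k j + (cyc ^^ (i - 1)) (p k) ! (j - 1)"
  by (cases i) (auto simp: shift_sum_def)

text \<open>
  The key identity: a cyclic shift changes the \<open>\<alpha>\<close>-exponent by \<open>L\<close>, up to an amount independent of
  \<open>j\<close>.  The amount is harmless because constant vectors become trivial modulo
  \<open>\<alpha>\<^sub>1 \<cdots> \<alpha>\<^sub>n = 1\<close>.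
\<close>

lemma alpha_exp_shift:
  assumes "j \<in> {1..n}"
  shows "alpha_exp (shift f) j + (\<Sum>k=1..l. int (f (n, k)) * sum_list (p k)) = alpha_exp f j + L_coord f j"
proof -
  have "alpha_exp (shift f) j + (\<Sum>k=1..l. int (f (n, k)) * sum_list (p k)) =
      (\<Sum>k=1..l. (\<Sum>i=1..n. int (f (if i = 1 then n else i - 1, k)) * shift_sum (i - 1) k j) +
        int (f (n, k)) * shift_sum n k j)"
    using shift_sum_n assms by (simp add: alpha_exp_def shift_def sum.distrib)
  also have "\<dots> = (\<Sum>k=1..l. \<Sum>i=1..n. int (f (i, k)) * shift_sum i k j)"
    by (intro sum.cong refl summation_by_parts[where a = "\<lambda>i. int (f (i, _))"])
      (use n_pos in \<open>auto simp: shift_sum_def\<close>)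
  also have "\<dots> = alpha_exp f j + L_coord f j"
    by (simp add: alpha_exp_def L_coord_def shift_sum_Suc distrib_left sum.distrib)
  finally show ?thesis .
qed

text \<open>
  The same summation by parts with \<open>s i = i\<close>; the boundary term is a multiple of \<open>n\<close> and disappears in
  the power of \<open>\<zeta>\<close>.
\<close>

lemma zeta_exp_shift: "zeta_exp (shift f) + (\<Sum>k=1..l. f (n, k)) * n = zeta_exp f + total f"
proof -
  have "zeta_exp (shift f) + (\<Sum>k=1..l. f (n, k)) * n =
      (\<Sum>k=1..l. (\<Sum>i=1..n. f (if i = 1 then n else i - 1, k) * (i - 1)) + f (n, k) * n)"
    by (simp add: zeta_exp_def shift_def sum.distrib sum_distrib_right)
  also have "\<dots> = (\<Sum>k=1..l. \<Sum>i=1..n. f (i, k) * i)"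
    by (intro sum.cong refl summation_by_parts[where a = "\<lambda>i. f (i, _)" and s = "\<lambda>i. i"])
      (use n_pos in auto)
  also have "\<dots> = (\<Sum>k=1..l. \<Sum>i=1..n. f (i, k) * (i - 1) + f (i, k))"
    by (intro sum.cong refl) (auto simp: algebra_simps)
  also have "\<dots> = zeta_exp f + total f"
    by (simp add: zeta_exp_def total_def sum.distrib)
  finally show ?thesis .
qed

lemma root_power_shift: "\<zeta> ^ zeta_exp (shift f) = \<zeta> ^ total f * \<zeta> ^ zeta_exp f"
proof -
  have "\<zeta> ^ (zeta_exp (shift f) + (\<Sum>k=1..l. f (n, k)) * n) = \<zeta> ^ (zeta_exp f + total f)"
    by (simp only: zeta_exp_shift)
  then show ?thesis
    by (simp add: power_add power_mult root mult.commute[of _ n] mult_ac)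
qed

lemma root_nonzero: "\<zeta> \<noteq> 0"
  using root n_pos by (metis zero_neq_one power_0_left not_gr_zero)

lemma lookup_exponent:
  "Poly_Mapping.lookup (exponent f) (i, k) = (if i \<in> {1..n} \<and> k \<in> {1..l} then f (i, k) else 0)"
proof -
  have "Poly_Mapping.lookup (exponent f) (i, k) =
      (\<Sum>k'=1..l. \<Sum>i'=1..n. if k' = k \<and> i' = i then f (i, k) else 0)"
    unfolding exponent_def lookup_sum
    by (intro sum.cong refl) (auto simp: lookup_single when_def)
  also have "\<dots> = (\<Sum>k'=1..l. if k' = k then (\<Sum>i'=1..n. if i' = i then f (i, k) else 0) else 0)"
    by (intro sum.cong refl) auto
  also have "\<dots> = (if i \<in> {1..n} \<and> k \<in> {1..l} then f (i, k) else 0)"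
    by (simp add: sum.delta)
  finally show ?thesis .
qed

lemma keys_exponent: "Poly_Mapping.keys (exponent f) \<subseteq> {1..n} \<times> {1..l}"
  by (auto simp: in_keys_iff lookup_exponent split: if_splits)

lemma exponent_lookup: "Poly_Mapping.keys e \<subseteq> {1..n} \<times> {1..l} \<Longrightarrow> exponent (Poly_Mapping.lookup e) = e"
  by (rule poly_mapping_eqI) (clarsimp simp: lookup_exponent subset_iff, metis not_in_keys_iff_lookup_eq_zero)

lemma exponent_add: "exponent (\<lambda>x. f x + g x) = exponent f + exponent g"
  by (simp add: exponent_def single_add sum.distrib)

lemma exponent_cong:
  "(\<And>i k. i \<in> {1..n} \<Longrightarrow> k \<in> {1..l} \<Longrightarrow> f (i, k) = g (i, k)) \<Longrightarrow> exponent f = exponent g"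
  by (simp add: exponent_def)

lemma stat_cong:
  assumes "\<And>i k. i \<in> {1..n} \<Longrightarrow> k \<in> {1..l} \<Longrightarrow> f (i, k) = g (i, k)"
  shows "total f = total g" "L_coord f = L_coord g" "alpha_exp f = alpha_exp g" "zeta_exp f = zeta_exp g"
  using assms by (simp_all add: total_def L_coord_def alpha_exp_def zeta_exp_def fun_eq_iff)

lemma stat_exponent [simp]:
  "total (Poly_Mapping.lookup (exponent f)) = total f"
  "L_coord (Poly_Mapping.lookup (exponent f)) = L_coord f"
  "alpha_exp (Poly_Mapping.lookup (exponent f)) = alpha_exp f"
  "zeta_exp (Poly_Mapping.lookup (exponent f)) = zeta_exp f"
  by (rule stat_cong; simp add: lookup_exponent)+

section \<open>Multi-indices as lists\<close>

definition of_list :: "nat list \<Rightarrow> nat \<times> nat \<Rightarrow> nat" where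
  "of_list \<nu> = (\<lambda>(i, k). \<nu> ! ((k - 1) * n + (i - 1)))"

definition to_list :: "(nat \<times> nat \<Rightarrow> nat) \<Rightarrow> nat list" where
  "to_list f = map (\<lambda>t. f (t mod n + 1, t div n + 1)) [0..<n * l]"

lemma index_less:
  assumes "k < l" "m < n"
  shows "k * n + m < n * l"
proof -
  have "k * n + m < Suc k * n" using assms(2) by simp
  also have "\<dots> \<le> l * n" using assms(1) by (intro mult_right_mono) auto
  finally show ?thesis by (simp add: mult.commute)
qed

lemma of_list_to_list:
  assumes "i \<in> {1..n}" "k \<in> {1..l}"
  shows "of_list (to_list f) (i, k) = f (i, k)"
proof -
  obtain i' k' where "i = Suc i'" "k = Suc k'" "i' < n" "k' < l"
    using assms by (cases i; cases k) auto
  then show ?thesis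
    using index_less[of k' i'] by (simp add: of_list_def to_list_def)
qed

lemma par_power: "par i k ^ r = Poly_Mapping.single (0, Poly_Mapping.single (i, k) r) 1"
  by (induction r) (simp_all add: par_def mult_single flip: single_add zero_prod_def)

lemma prod_monomials:
  "(\<Prod>x\<in>A. Poly_Mapping.single (0 :: nat \<Rightarrow>\<^sub>0 int, g x) (1 :: complex)) = Poly_Mapping.single (0, \<Sum>x\<in>A. g x) 1"
  by (induction A rule: infinite_finite_induct) (simp_all add: mult_single flip: zero_prod_def)

lemma sum_shift_index: "(\<Sum>m=0..<n. g (Suc m)) = (\<Sum>i=1..n. g i)"
  for g :: "nat \<Rightarrow> 'a::comm_monoid_add"
  using sum.shift_bounds_Suc_ivl[of g 0 n] by (simp add: atLeastLessThanSuc_atLeastAtMost)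

lemma nu_monom_eq: "nu_monom n l \<nu> = Poly_Mapping.single (0, exponent (of_list \<nu>)) 1"
proof -
  have "nu_monom n l \<nu> = Poly_Mapping.single (0, \<Sum>k=1..l. \<Sum>m=0..<n.
      Poly_Mapping.single (Suc m, k) (of_list \<nu> (Suc m, k))) 1"
    by (simp add: nu_monom_def par_power prod_monomials of_list_def)
  then show ?thesis
    unfolding sum_shift_index[where g = "\<lambda>i. Poly_Mapping.single (i, _) (of_list \<nu> (i, _))"]
    by (simp add: exponent_def)
qed

lemma par_prod_power: "par_prod n l ^ r = Poly_Mapping.single (0, exponent (\<lambda>_. r)) 1"
proof -
  have "par_prod n l ^ r = (\<Prod>k=1..l. \<Prod>i=1..n. par i k ^ r)"
    unfolding par_prod_def prod.swap[of _ "{1..l}" "{1..n}"] by (simp add: prod_power_distrib)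
  then show ?thesis
    by (simp add: par_power prod_monomials exponent_def)
qed

lemma L_map_nth: "j \<in> {1..n} \<Longrightarrow> L_map n l p \<nu> ! (j - 1) = L_coord (of_list \<nu>) j"
  using sum_shift_index[of "\<lambda>i. int (of_list \<nu> (i, _)) * ((cyc ^^ (i - 1)) (p _) ! (j - 1))"]
  by (auto simp: L_map_def L_coord_def of_list_def)

lemma L_map_constant:
  "L_map n l p \<nu> = replicate n (int K) \<longleftrightarrow> (\<forall>j\<in>{1..n}. L_coord (of_list \<nu>) j = int K)"
proof -
  have "L_map n l p \<nu> = replicate n (int K) \<longleftrightarrow> (\<forall>j<n. L_map n l p \<nu> ! j = int K)"
    by (auto simp: list_eq_iff_nth_eq L_map_def)
  also have "\<dots> \<longleftrightarrow> (\<forall>j\<in>{1..n}. L_map n l p \<nu> ! (j - 1) = int K)"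
    unfolding image_Suc_lessThan[symmetric] by auto
  finally show ?thesis by (simp add: L_map_nth del: One_nat_def)
qed

lemma sum_list_total:
  assumes "length \<nu> = n * l"
  shows "sum_list \<nu> = total (of_list \<nu>)"
proof -
  have "sum_list \<nu> = (\<Sum>k<l. \<Sum>t=k * n..<k * n + n. \<nu> ! t)"
    using assms by (simp add: sum_list_sum_nth sum.nat_group atLeast0LessThan mult.commute)
  also have "\<dots> = (\<Sum>k<l. \<Sum>m=0..<n. of_list \<nu> (Suc m, Suc k))"
    by (simp add: of_list_def sum.shift_bounds_nat_ivl[of _ 0, simplified] add.commute)
  also have "\<dots> = (\<Sum>k<l. \<Sum>i=1..n. of_list \<nu> (i, Suc k))"
    by (intro sum.cong refl sum_shift_index[where g = "\<lambda>i. of_list \<nu> (i, Suc _)"])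
  also have "\<dots> = total (of_list \<nu>)"
    unfolding total_def by (rule sum.reindex_bij_witness[of _ "\<lambda>k. k - 1" Suc]) auto
  finally show ?thesis .
qed

lemma nth_concat_blocks:
  assumes "\<And>k. k < L \<Longrightarrow> length (g k) = n" "k < L" "m < n"
  shows "concat (map g [0..<L]) ! (k * n + m) = g k ! m"
  using assms
proof (induction L)
  case (Suc L)
  have "length (concat (map g [0..<M])) = M * n" if "M \<le> L" for M
    using that Suc.prems(1) by (induction M) auto
  then have len: "length (concat (map g [0..<L])) = L * n" by simp
  show ?case
  proof (cases "k = L")
    case False
    then have "k < L" using Suc.prems by simp
    then have "k * n + m < L * n"
      using mult_le_mono1[of "Suc k" L n] Suc.prems(3) by simp
    then show ?thesis
      using Suc \<open>k < L\<close> len by (simp add: nth_append)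
  qed (use Suc len in \<open>simp add: nth_append\<close>)
qed simp

lemma of_list_hat:
  assumes "length \<nu> = n * l" "i \<in> {1..n}" "k \<in> {1..l}"
  shows "of_list (hat n l \<nu>) (i, k) = shift (of_list \<nu>) (i, k)"
proof -
  let ?b = "\<lambda>k. take n (drop (k * n) \<nu>)"
  have lb: "length (?b k) = n" if "k < l" for k
  proof -
    have "Suc k * n \<le> l * n" using that by (intro mult_right_mono) auto
    then show ?thesis using assms(1) by (simp add: mult.commute)
  qed
  have lk: "length (?b (k - 1)) = n" using assms(3) by (intro lb) auto
  then have ne: "?b (k - 1) \<noteq> []" using n_pos by fastforce
  have "of_list (hat n l \<nu>) (i, k) = cyc (?b (k - 1)) ! (i - 1)"
    unfolding hat_def of_list_def using assms lb
    by (simp only: prod.case, intro nth_concat_blocks) auto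
  also have "\<dots> = ?b (k - 1) ! ((i - 1 + (n - 1)) mod n)"
    by (rule nth_cyc[OF ne, of "i - 1", unfolded lk]) (use assms(2) in auto)
  also have "(i - 1 + (n - 1)) mod n = (if i = 1 then n else i - 1) - 1"
  proof (cases "i = 1")
    case False
    then have "i - 1 + (n - 1) = (i - 2) + n" "i - 2 < n" using assms by auto
    then show ?thesis using False by (simp only: mod_add_self2 mod_less if_False)
  qed (use n_pos in simp)
  also have "?b (k - 1) ! ((if i = 1 then n else i - 1) - 1) = shift (of_list \<nu>) (i, k)"
    using assms n_pos lb[of "k - 1"] by (auto simp: shift_def of_list_def)
  finally show ?thesis .
qed

definition I_R_gens :: "lpoly set" where
  "I_R_gens = {Poly_Mapping.single (0, exponent f) (\<zeta> ^ total f) -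
      Poly_Mapping.single (0, exponent (shift f)) 1 | f. \<exists>K::nat. \<forall>j\<in>{1..n}. L_coord f j = int K}"

lemma I_R_eq: "I_R n l p \<zeta> = Idl\<^bsub>param_ring n l\<^esub> I_R_gens"
proof -
  let ?b = "\<lambda>f. Poly_Mapping.single (0, exponent f) (\<zeta> ^ total f) -
      Poly_Mapping.single (0, exponent (shift f)) 1 :: lpoly"
  have list: "const (\<zeta> ^ sum_list \<nu>) * nu_monom n l \<nu> - nu_monom n l (hat n l \<nu>) = ?b (of_list \<nu>)"
    if "length \<nu> = n * l" for \<nu>
    using that exponent_cong[of "of_list (hat n l \<nu>)" "shift (of_list \<nu>)", OF of_list_hat[OF that]]
    by (simp add: nu_monom_eq const_def mult_single sum_list_total)
  have "?b f \<in> {?b (of_list \<nu>) | \<nu>. \<nu> \<in> M_set n l p}" if "\<forall>j\<in>{1..n}. L_coord f j = int K" for f K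
  proof -
    have eq: "of_list (to_list f) (i, k) = f (i, k)" if "i \<in> {1..n}" "k \<in> {1..l}" for i k
      by (rule of_list_to_list[OF that])
    have "exponent (shift (of_list (to_list f))) = exponent (shift f)"
      by (rule exponent_cong, unfold shift_def prod.case, rule of_list_to_list) (use n_pos in auto)
    then have "?b f = ?b (of_list (to_list f))"
      using exponent_cong[of "of_list (to_list f)" f, OF eq] stat_cong(1)[of "of_list (to_list f)" f, OF eq] by simp
    moreover have "to_list f \<in> M_set n l p"
      using that stat_cong(2)[of "of_list (to_list f)" f, OF eq] by (auto simp: M_set_def L_map_constant to_list_def)
    ultimately show ?thesis by blast
  qed
  moreover have "?b (of_list \<nu>) \<in> I_R_gens" if "\<nu> \<in> M_set n l p" for \<nu>
    using that by (auto simp: M_set_def L_map_constant I_R_gens_def)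
  moreover have "{const (\<zeta> ^ sum_list \<nu>) * nu_monom n l \<nu> - nu_monom n l (hat n l \<nu>) | \<nu>. \<nu> \<in> M_set n l p}
      = {?b (of_list \<nu>) | \<nu>. \<nu> \<in> M_set n l p}"
    unfolding setcompr_eq_image by (rule image_cong) (simp_all add: list M_set_def)
  ultimately have "{const (\<zeta> ^ sum_list \<nu>) * nu_monom n l \<nu> - nu_monom n l (hat n l \<nu>) | \<nu>. \<nu> \<in> M_set n l p}
      = I_R_gens"
    by (auto simp: I_R_gens_def)
  then show ?thesis by (simp add: I_R_def)
qed

section \<open>The normal form of a Laurent monomial\<close>

text \<open>
  The exponent of the normal form: parameters are rewritten through those with first index \<open>1\<close>, and
  subtracting the \<open>n\<close>-th coordinate from all coordinates eliminates \<open>\<alpha>\<^sub>n\<close> by means of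
  \<open>\<alpha>\<^sub>1 \<cdots> \<alpha>\<^sub>n = 1\<close>.
\<close>

definition nf_exp :: "(nat \<Rightarrow>\<^sub>0 int) \<times> (nat \<times> nat \<Rightarrow>\<^sub>0 nat) \<Rightarrow> (nat \<Rightarrow>\<^sub>0 int) \<times> (nat \<times> nat \<Rightarrow>\<^sub>0 nat)" where
  "nf_exp = (\<lambda>(u, e).
     (\<Sum>j=1..n. Poly_Mapping.single j
        ((Poly_Mapping.lookup u j + alpha_exp (Poly_Mapping.lookup e) j) -
         (Poly_Mapping.lookup u n + alpha_exp (Poly_Mapping.lookup e) n)),
      \<Sum>k=1..l. Poly_Mapping.single (1, k) (\<Sum>i=1..n. Poly_Mapping.lookup e (i, k))))"

definition nf_coeff :: "(nat \<Rightarrow>\<^sub>0 int) \<times> (nat \<times> nat \<Rightarrow>\<^sub>0 nat) \<Rightarrow> complex" where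
  "nf_coeff = (\<lambda>(u, e). \<zeta> ^ zeta_exp (Poly_Mapping.lookup e))"

definition normal_form :: "lpoly \<Rightarrow> lpoly" where
  "normal_form = relabel nf_exp nf_coeff"

lemma alpha_exp_add: "alpha_exp (\<lambda>x. f x + g x) j = alpha_exp f j + alpha_exp g j"
  by (simp add: alpha_exp_def distrib_right sum.distrib)

lemma zeta_exp_add: "zeta_exp (\<lambda>x. f x + g x) = zeta_exp f + zeta_exp g"
  by (simp add: zeta_exp_def distrib_right sum.distrib)

lemma nf_exp_add: "nf_exp (x + y) = nf_exp x + nf_exp y"
  by (cases x; cases y)
    (simp add: nf_exp_def lookup_add[abs_def] alpha_exp_add sum.distrib flip: single_add,
     simp add: algebra_simps single_add single_diff sum.distrib sum_subtractf)

lemma nf_coeff_add: "nf_coeff (x + y) = nf_coeff x * nf_coeff y"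
  by (cases x; cases y) (simp add: nf_coeff_def lookup_add[abs_def] zeta_exp_add power_add)

lemma nf_coeff_nonzero [simp]: "nf_coeff x \<noteq> 0"
  by (cases x) (simp add: nf_coeff_def root_nonzero)

lemma nf_exp_0 [simp]: "nf_exp 0 = 0"
  using nf_exp_add[of 0 0] by (metis add.right_neutral add_left_cancel)

lemma nf_coeff_0 [simp]: "nf_coeff 0 = 1"
  using nf_coeff_add[of 0 0] by simp

lemma normal_form_mult: "normal_form (f * g) = normal_form f * normal_form g"
  unfolding normal_form_def by (rule relabel_mult) (simp_all add: nf_exp_add nf_coeff_add)

lemma nf_exp_eqI:
  assumes "\<And>j. j \<in> {1..n} \<Longrightarrow>
      Poly_Mapping.lookup u j + alpha_exp (Poly_Mapping.lookup e) j =
      Poly_Mapping.lookup v j + alpha_exp (Poly_Mapping.lookup d) j + c"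
    and "\<And>k. k \<in> {1..l} \<Longrightarrow>
      (\<Sum>i=1..n. Poly_Mapping.lookup e (i, k)) = (\<Sum>i=1..n. Poly_Mapping.lookup d (i, k))"
  shows "nf_exp (u, e) = nf_exp (v, d)"
  using assms n_pos by (simp add: nf_exp_def del: One_nat_def)

lemma nf_exp_eqD:
  assumes eq: "nf_exp (0, e) = nf_exp (0, d)"
  shows "\<exists>c. \<forall>j\<in>{1..n}. alpha_exp (Poly_Mapping.lookup d) j - alpha_exp (Poly_Mapping.lookup e) j = c"
    and "k \<in> {1..l} \<Longrightarrow>
      (\<Sum>i=1..n. Poly_Mapping.lookup e (i, k)) = (\<Sum>i=1..n. Poly_Mapping.lookup d (i, k))"
proof -
  have "alpha_exp (Poly_Mapping.lookup d) j - alpha_exp (Poly_Mapping.lookup e) j =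
      alpha_exp (Poly_Mapping.lookup d) n - alpha_exp (Poly_Mapping.lookup e) n" if "j \<in> {1..n}" for j
    using arg_cong[OF eq, of "\<lambda>x. Poly_Mapping.lookup (fst x) j"] that
    by (simp add: nf_exp_def lookup_sum_single)
  then show "\<exists>c. \<forall>j\<in>{1..n}. alpha_exp (Poly_Mapping.lookup d) j - alpha_exp (Poly_Mapping.lookup e) j = c"
    by blast
  show "(\<Sum>i=1..n. Poly_Mapping.lookup e (i, k)) = (\<Sum>i=1..n. Poly_Mapping.lookup d (i, k))"
    if "k \<in> {1..l}"
  proof -
    have "Poly_Mapping.lookup (snd (nf_exp (0, e))) (1, k) = (\<Sum>i=1..n. Poly_Mapping.lookup e (i, k))"
      for e using that by (simp add: nf_exp_def lookup_sum lookup_single when_def)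
    then show ?thesis using eq by metis
  qed
qed

text \<open>
  Constant \<open>L\<close> means that the shift moves the \<open>\<alpha>\<close>-exponent by a constant vector, which the normal form
  discards; the scalar it picks up is exactly the coefficient in the generators of \<open>I_R\<close>, which are
  therefore in the kernel.
\<close>

lemma nf_shift:
  assumes "\<forall>j\<in>{1..n}. L_coord f j = c"
  shows "nf_exp (0, exponent (shift f)) = nf_exp (0, exponent f)"
    and "nf_coeff (0, exponent (shift f)) = \<zeta> ^ total f * nf_coeff (0, exponent f)"
proof -
  show "nf_exp (0, exponent (shift f)) = nf_exp (0, exponent f)"
  proof (rule nf_exp_eqI)
    fix j assume "j \<in> {1..n}"
    then show "Poly_Mapping.lookup 0 j + alpha_exp (Poly_Mapping.lookup (exponent (shift f))) j =
        Poly_Mapping.lookup 0 j + alpha_exp (Poly_Mapping.lookup (exponent f)) j +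
        (c - (\<Sum>k=1..l. int (f (n, k)) * sum_list (p k)))"
      using alpha_exp_shift[of j f] assms by simp
  next
    fix k assume "k \<in> {1..l}"
    then show "(\<Sum>i=1..n. Poly_Mapping.lookup (exponent (shift f)) (i, k)) =
        (\<Sum>i=1..n. Poly_Mapping.lookup (exponent f) (i, k))"
      using shift_column_sum[of f k] by (simp add: lookup_exponent)
  qed
  show "nf_coeff (0, exponent (shift f)) = \<zeta> ^ total f * nf_coeff (0, exponent f)"
    by (simp add: nf_coeff_def root_power_shift)
qed

abbreviation unit :: "nat \<Rightarrow> nat \<Rightarrow> nat \<times> nat \<Rightarrow>\<^sub>0 nat" where
  "unit i k \<equiv> Poly_Mapping.single (i, k) 1"

definition vec :: "int list \<Rightarrow> nat \<Rightarrow>\<^sub>0 int" where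
  "vec v = (\<Sum>j=1..n. Poly_Mapping.single j (v ! (j - 1)))"

lemma sum_unit:
  assumes "i \<in> {1..n}" "k \<in> {1..l}"
  shows "(\<Sum>k'=1..l. \<Sum>i'=1..n. of_nat (Poly_Mapping.lookup (unit i k) (i', k')) * g i' k') =
    (g i k :: 'b::comm_semiring_1)"
proof -
  have "(\<Sum>k'=1..l. \<Sum>i'=1..n. of_nat (Poly_Mapping.lookup (unit i k) (i', k')) * g i' k') =
      (\<Sum>k'=1..l. if k' = k then (\<Sum>i'=1..n. if i' = i then g i k else 0) else 0)"
  proof (intro sum.cong[OF refl])
    fix k'
    have "of_nat (Poly_Mapping.lookup (unit i k) (i', k')) * g i' k' =
        (if k' = k then if i' = i then g i k else 0 else 0)" for i'
      by (simp add: lookup_single when_def)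
    then show "(\<Sum>i'=1..n. of_nat (Poly_Mapping.lookup (unit i k) (i', k')) * g i' k') =
        (if k' = k then (\<Sum>i'=1..n. if i' = i then g i k else 0) else 0)"
      by (cases "k' = k") (simp_all only: if_True if_False refl sum.neutral_const)
  qed
  then show ?thesis using assms by simp
qed

lemma alpha_exp_unit:
  "i \<in> {1..n} \<Longrightarrow> k \<in> {1..l} \<Longrightarrow> alpha_exp (Poly_Mapping.lookup (unit i k)) j = shift_sum (i - 1) k j"
  unfolding alpha_exp_def by (rule sum_unit)

lemma zeta_exp_unit:
  "i \<in> {1..n} \<Longrightarrow> k \<in> {1..l} \<Longrightarrow> zeta_exp (Poly_Mapping.lookup (unit i k)) = i - 1"
  using sum_unit[of i k "\<lambda>i k. i - 1"] by (simp add: zeta_exp_def)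

lemma column_unit:
  "i \<in> {1..n} \<Longrightarrow> (\<Sum>i'=1..n. Poly_Mapping.lookup (unit i k) (i', k')) = (if k' = k then 1 else 0)"
  by (simp add: lookup_single when_def)

text \<open>
  One step of the recursion.  The step from \<open>n\<close> back to \<open>1\<close> is consistent because the sum of all shifts
  of \<open>p k\<close> is the constant vector of its coordinate sum, and \<open>\<zeta>\<^sup>n = 1\<close>.
\<close>

lemma nf_generator:
  assumes "i \<in> {1..n}" "k \<in> {1..l}"
  shows "nf_exp (vec ((cyc ^^ (i - 1)) (p k)), unit i k) = nf_exp (0, unit (i mod n + 1) k)"
    and "nf_coeff (0, unit (i mod n + 1) k) =
      \<zeta> * nf_coeff (vec ((cyc ^^ (i - 1)) (p k)), unit i k)"
proof -
  have i': "i mod n + 1 \<in> {1..n}" using n_pos by (simp add: Suc_leI)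
  show "nf_exp (vec ((cyc ^^ (i - 1)) (p k)), unit i k) = nf_exp (0, unit (i mod n + 1) k)"
  proof (rule nf_exp_eqI)
    fix j assume j: "j \<in> {1..n}"
    have "Poly_Mapping.lookup (vec ((cyc ^^ (i - 1)) (p k))) j + alpha_exp (Poly_Mapping.lookup (unit i k)) j =
        shift_sum i k j"
      using assms j shift_sum_Suc[of i k j] by (simp only: alpha_exp_unit) (simp add: vec_def lookup_sum_single)
    also have "\<dots> = shift_sum (i mod n) k j + (if i = n then sum_list (p k) else 0)"
      using assms j shift_sum_n[of k j] by (auto simp: shift_sum_def)
    finally show "Poly_Mapping.lookup (vec ((cyc ^^ (i - 1)) (p k))) j + alpha_exp (Poly_Mapping.lookup (unit i k)) j =
        Poly_Mapping.lookup 0 j + alpha_exp (Poly_Mapping.lookup (unit (i mod n + 1) k)) j +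
        (if i = n then sum_list (p k) else 0)"
      using alpha_exp_unit[OF i' assms(2)] by simp
  qed (simp only: column_unit[OF assms(1)] column_unit[OF i'])
  have "\<zeta> ^ (i mod n) = \<zeta> ^ i"
    using assms root by (cases "i = n") auto
  also have "\<dots> = \<zeta> * \<zeta> ^ (i - 1)"
    using assms by (cases i) auto
  finally show "nf_coeff (0, unit (i mod n + 1) k) =
      \<zeta> * nf_coeff (vec ((cyc ^^ (i - 1)) (p k)), unit i k)"
    using zeta_exp_unit[OF i' assms(2)] zeta_exp_unit[OF assms] by (simp add: nf_coeff_def)
qed

definition ones :: "int \<Rightarrow> nat \<Rightarrow>\<^sub>0 int" where
  "ones c = (\<Sum>j=1..n. Poly_Mapping.single j c)"

lemma ones_0 [simp]: "ones 0 = 0" and ones_add: "ones (c + d) = ones c + ones d"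
  by (simp_all add: ones_def single_add sum.distrib)

lemma nf_ones: "nf_exp (ones c, 0) = 0" "nf_coeff (u, 0) = 1"
  using nf_exp_eqI[of "ones c" 0 0 0 c] nf_exp_0
  by (simp_all add: ones_def lookup_sum_single nf_coeff_def zeta_exp_def flip: zero_prod_def)

definition laurent_gens :: "lpoly set" where
  "laurent_gens = {1 - Poly_Mapping.single (ones 1, 0) 1} \<union>
    {Poly_Mapping.single (vec ((cyc ^^ (i - 1)) (p k)), unit i k) \<zeta> -
      Poly_Mapping.single (0, unit (i mod n + 1) k) 1 | i k. i \<in> {1..n} \<and> k \<in> {1..l}}"

lemma prod_alpha: "(\<Prod>j\<in>A. alpha j) = Poly_Mapping.single (\<Sum>j\<in>A. Poly_Mapping.single j 1, 0) 1"
  by (induction A rule: infinite_finite_induct) (simp_all add: alpha_def mult_single flip: zero_prod_def)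

lemma I_laurent_eq: "I_laurent n l p \<zeta> = Idl\<^bsub>laurent_ring n l\<^esub> laurent_gens"
proof -
  have "const \<zeta> * par i k * alpha_pow ((cyc ^^ (i - 1)) (p k)) - par (i mod n + 1) k =
      Poly_Mapping.single (vec ((cyc ^^ (i - 1)) (p k)), unit i k) \<zeta> -
      Poly_Mapping.single (0, unit (i mod n + 1) k) 1" if "k \<in> {1..l}" for i k
    using len[OF that]
    by (simp add: const_def par_def alpha_pow_def vec_def mult_single)
  then have "{const \<zeta> * par i k * alpha_pow ((cyc ^^ (i - 1)) (p k)) - par (i mod n + 1) k | i k.
      i \<in> {1..n} \<and> k \<in> {1..l}} =
    {Poly_Mapping.single (vec ((cyc ^^ (i - 1)) (p k)), unit i k) \<zeta> -
      Poly_Mapping.single (0, unit (i mod n + 1) k) 1 | i k. i \<in> {1..n} \<and> k \<in> {1..l}}"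
    by (intro Collect_cong ex_cong1) (metis (no_types, lifting))
  then show ?thesis
    by (simp add: I_laurent_def laurent_gens_def prod_alpha ones_def)
qed

section \<open>Both ideals lie in the kernel of the normal form\<close>

definition supported :: "(nat \<Rightarrow>\<^sub>0 int) \<times> (nat \<times> nat \<Rightarrow>\<^sub>0 nat) \<Rightarrow> bool" where
  "supported = (\<lambda>(u, e). Poly_Mapping.keys u \<subseteq> {1..n} \<and> Poly_Mapping.keys e \<subseteq> {1..n} \<times> {1..l})"

lemma carrier_laurent: "carrier (laurent_ring n l) = {f. \<forall>x\<in>Poly_Mapping.keys f. supported x}"
  by (auto simp: laurent_ring_def ring_on_def supported_def)

lemma carrier_param:
  "carrier (param_ring n l) = {f. \<forall>x\<in>Poly_Mapping.keys f. supported x \<and> fst x = 0}"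
  by (auto simp: param_ring_def ring_on_def supported_def split: prod.splits)

lemma single_laurent: "supported x \<Longrightarrow> Poly_Mapping.single x c \<in> carrier (laurent_ring n l)"
  by (simp add: carrier_laurent)

lemma single_param: "Poly_Mapping.single (0, exponent f) c \<in> carrier (param_ring n l)"
  using keys_exponent by (simp add: carrier_param supported_def)

lemma keys_sum_singles: "finite A \<Longrightarrow> Poly_Mapping.keys (\<Sum>j\<in>A. Poly_Mapping.single j (c j)) \<subseteq> A"
  by (auto simp: in_keys_iff lookup_sum_single split: if_splits)

lemma supported_add: "supported x \<Longrightarrow> supported y \<Longrightarrow> supported (x + y)"
  by (cases x; cases y) (auto simp: supported_def dest!: subsetD[OF Poly_Mapping.keys_add])

lemma supported_nf_exp: "supported (nf_exp x)"
proof -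
  have "(\<Sum>k=1..l. Poly_Mapping.single (1::nat, k) (c k)) = (\<Sum>x\<in>{1::nat}\<times>{1..l}. Poly_Mapping.single x (c (snd x)))"
    for c :: "nat \<Rightarrow> nat"
    by (rule sum.reindex_bij_witness[of _ snd "Pair 1"]) auto
  then have "Poly_Mapping.keys (\<Sum>k=1..l. Poly_Mapping.single (1::nat, k) (c k)) \<subseteq> {1::nat} \<times> {1..l}"
    for c :: "nat \<Rightarrow> nat"
    using keys_sum_singles[of "{1::nat} \<times> {1..l}" "\<lambda>x. c (snd x)"] by (simp del: One_nat_def)
  then show ?thesis
    using n_pos keys_sum_singles[of "{1..n}"]
    by (cases x) (force simp: nf_exp_def supported_def simp del: One_nat_def)
qed

lemma supported_gens:
  "supported (0, 0)" "supported (ones c, 0)" "supported (vec v, 0)"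
  "i \<in> {1..n} \<Longrightarrow> k \<in> {1..l} \<Longrightarrow> supported (0, unit i k)"
proof -
  have "Poly_Mapping.keys (ones c) \<subseteq> {1..n}" "Poly_Mapping.keys (vec v) \<subseteq> {1..n}"
    unfolding ones_def vec_def by (rule keys_sum_singles, simp)+
  then show "supported (ones c, 0)" "supported (vec v, 0)"
    by (simp_all add: supported_def)
qed (simp_all add: supported_def)

lemma supported_vec_unit: "i \<in> {1..n} \<Longrightarrow> k \<in> {1..l} \<Longrightarrow> supported (vec v, unit i k)"
  using supported_add[OF supported_gens(3) supported_gens(4)] by simp

lemma laurent_ring_on: "laurent_ring n l = ring_on (carrier (laurent_ring n l))"
  and param_ring_on: "param_ring n l = ring_on (carrier (param_ring n l))"
  by (simp_all add: laurent_ring_def param_ring_def ring_on_def)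

lemma carrier_laurent_diff:
  "f \<in> carrier (laurent_ring n l) \<Longrightarrow> g \<in> carrier (laurent_ring n l) \<Longrightarrow> f - g \<in> carrier (laurent_ring n l)"
  using keys_diff by (fastforce simp: carrier_laurent)

lemma carrier_param_diff:
  "f \<in> carrier (param_ring n l) \<Longrightarrow> g \<in> carrier (param_ring n l) \<Longrightarrow> f - g \<in> carrier (param_ring n l)"
  using keys_diff by (fastforce simp: carrier_param)

interpretation laurent: generated_ideal "carrier (laurent_ring n l)" laurent_gens
  rewrites "Idl\<^bsub>ring_on (carrier (laurent_ring n l))\<^esub> laurent_gens = I_laurent n l p \<zeta>"
proof -
  have "laurent_gens \<subseteq> carrier (laurent_ring n l)"
    unfolding laurent_gens_def
    using supported_gens supported_vec_unit n_pos
    by (auto intro!: carrier_laurent_diff single_laurent simp: zero_prod_def Suc_le_eq simp flip: single_one)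
  then show "generated_ideal (carrier (laurent_ring n l)) laurent_gens"
    by (intro generated_ideal.intro) (simp_all add: cring_laurent_ring flip: laurent_ring_on)
qed (simp add: I_laurent_eq flip: laurent_ring_on)

interpretation param: generated_ideal "carrier (param_ring n l)" I_R_gens
  rewrites "Idl\<^bsub>ring_on (carrier (param_ring n l))\<^esub> I_R_gens = I_R n l p \<zeta>"
proof -
  have "I_R_gens \<subseteq> carrier (param_ring n l)"
    by (auto simp: I_R_gens_def intro!: carrier_param_diff single_param)
  then show "generated_ideal (carrier (param_ring n l)) I_R_gens"
    by (intro generated_ideal.intro) (simp_all add: cring_param_ring flip: param_ring_on)
qed (simp add: I_R_eq flip: param_ring_on)

lemma normal_form_I_laurent: "f \<in> I_laurent n l p \<zeta> \<Longrightarrow> normal_form f = 0"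
proof -
  have "I_laurent n l p \<zeta> \<subseteq> {f. normal_form f = 0}"
  proof (rule laurent.Idl_minimal)
    show "laurent_gens \<subseteq> {f. normal_form f = 0}"
      using nf_generator nf_ones
      by (auto simp: mult.commute[of _ \<zeta>] laurent_gens_def normal_form_def relabel_diff simp flip: single_one simp del: One_nat_def)
  qed (auto simp: normal_form_def relabel_add normal_form_mult[unfolded normal_form_def])
  then show "f \<in> I_laurent n l p \<zeta> \<Longrightarrow> normal_form f = 0" by auto
qed

lemma normal_form_I_R: "f \<in> I_R n l p \<zeta> \<Longrightarrow> normal_form f = 0"
proof -
  have "I_R n l p \<zeta> \<subseteq> {f. normal_form f = 0}"
  proof (rule param.Idl_minimal)
    show "I_R_gens \<subseteq> {f. normal_form f = 0}"
    proof
      fix g assume "g \<in> I_R_gens"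
      then obtain f K where "\<forall>j\<in>{1..n}. L_coord f j = int K"
        and g: "g = Poly_Mapping.single (0, exponent f) (\<zeta> ^ total f) - Poly_Mapping.single (0, exponent (shift f)) 1"
        by (auto simp: I_R_gens_def)
      then show "g \<in> {f. normal_form f = 0}"
        using nf_shift[of f "int K"] by (simp add: normal_form_def relabel_diff mult.commute)
    qed
  qed (auto simp: normal_form_def relabel_add normal_form_mult[unfolded normal_form_def])
  then show "f \<in> I_R n l p \<zeta> \<Longrightarrow> normal_form f = 0" by auto
qed

text \<open>
  A power of \<open>par_prod\<close> has a nonzero multiple of a monomial as its normal form, and this can be
  cancelled.
\<close>

lemma normal_form_saturation:
  assumes "f \<in> saturation n l (I_R n l p \<zeta>)"
  shows "normal_form f = 0"
proof -
  obtain r where "par_prod n l ^ r * f \<in> I_R n l p \<zeta>"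
    using assms by (auto simp: saturation_def)
  then have "normal_form (par_prod n l ^ r) * normal_form f = 0"
    using normal_form_I_R by (simp flip: normal_form_mult)
  then show ?thesis
    unfolding par_prod_power normal_form_def relabel_single mult_1_right
    by (rule single_mult_eq_0D) simp
qed

section \<open>The kernel of the normal form\<close>

text \<open>
  Congruence of a monomial to its normal form modulo the Laurent ideal.  The exponents with this
  property form a submonoid, so only the variables have to be checked.
\<close>

definition normalizes :: "(nat \<Rightarrow>\<^sub>0 int) \<times> (nat \<times> nat \<Rightarrow>\<^sub>0 nat) \<Rightarrow> bool" where
  "normalizes x \<longleftrightarrow> supported x \<and>
     Poly_Mapping.single x 1 - Poly_Mapping.single (nf_exp x) (nf_coeff x) \<in> I_laurent n l p \<zeta>"

lemma normalizes_0: "normalizes 0"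
  using laurent.Idl_0 supported_gens(1) by (simp add: normalizes_def flip: zero_prod_def)

lemma normalizes_add:
  assumes x: "normalizes x" and y: "normalizes y"
  shows "normalizes (x + y)"
proof -
  let ?s = "Poly_Mapping.single"
  have "?s (x + y) 1 - ?s (nf_exp (x + y)) (nf_coeff (x + y)) =
      ?s x 1 * (?s y 1 - ?s (nf_exp y) (nf_coeff y)) +
      ?s (nf_exp y) (nf_coeff y) * (?s x 1 - ?s (nf_exp x) (nf_coeff x))"
    by (simp add: right_diff_distrib mult_single nf_exp_add nf_coeff_add add.commute mult.commute)
  moreover have "\<dots> \<in> I_laurent n l p \<zeta>"
    using x y by (intro laurent.Idl_add laurent.Idl_mult single_laurent supported_nf_exp)
      (simp_all add: normalizes_def)
  ultimately show ?thesis
    using x y supported_add by (simp add: normalizes_def)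
qed

lemma normalizes_sum:
  "(\<And>i. i \<in> A \<Longrightarrow> normalizes (0, g i)) \<Longrightarrow> normalizes (0, \<Sum>i\<in>A. g i)"
proof (induction A rule: infinite_finite_induct)
  case (insert i A)
  then show ?case using normalizes_add[of "(0, g i)" "(0, \<Sum>i\<in>A. g i)"] by simp
qed (use normalizes_0 in \<open>simp_all add: zero_prod_def\<close>)

text \<open>
  For nonnegative \<open>c\<close> this telescopes down to the generator \<open>1 - \<alpha>\<^sub>1 \<cdots> \<alpha>\<^sub>n\<close>; for negative \<open>c\<close> it is a
  unit multiple of the case \<open>- c\<close>.
\<close>

lemma alpha_ones_minus_1: "Poly_Mapping.single (ones c, 0) 1 - 1 \<in> I_laurent n l p \<zeta>"
proof -
  let ?s = "\<lambda>c. Poly_Mapping.single (ones c, 0) 1 :: lpoly"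
  have s: "?s c * ?s d = ?s (c + d)" for c d
    by (simp add: mult_single ones_add)
  have s0: "?s 0 = 1" unfolding ones_0 zero_prod_def[symmetric] by (rule single_one)
  have nat: "?s (int m) - 1 \<in> I_laurent n l p \<zeta>" for m
  proof (induction m)
    case 0 then show ?case using laurent.Idl_0 s0 by simp
  next
    case (Suc m)
    have "1 - ?s 1 \<in> I_laurent n l p \<zeta>"
      by (rule laurent.Idl_generator) (simp add: laurent_gens_def)
    moreover have "?s (int (Suc m)) - 1 = ?s 1 * (?s (int m) - 1) + - (1 - ?s 1)"
      by (simp add: right_diff_distrib s)
    ultimately show ?case
      using Suc by (simp only:)
        (intro laurent.Idl_add laurent.Idl_mult laurent.Idl_uminus single_laurent supported_gens)
  qed
  show ?thesis
  proof (cases "c \<ge> 0")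
    case True then show ?thesis using nat[of "nat c"] by simp
  next
    case False
    have "?s c - 1 = ?s c * - (?s (- c) - 1)"
      using s0 by (simp add: right_diff_distrib s)
    also have "\<dots> \<in> I_laurent n l p \<zeta>"
      using nat[of "nat (- c)"] False
      by (intro laurent.Idl_mult laurent.Idl_uminus single_laurent supported_gens) simp
    finally show ?thesis .
  qed
qed

text \<open>
  The exponent \<open>u\<close> differs from its normal form by a constant vector.
\<close>

lemma normalizes_alpha:
  assumes "Poly_Mapping.keys u \<subseteq> {1..n}"
  shows "normalizes (u, 0)"
proof -
  let ?c = "Poly_Mapping.lookup u n" and ?v = "nf_exp (u, 0)"
  have v: "?v + (ones ?c, 0) = (u, 0)"
  proof -
    have "fst ?v + ones ?c = u"
      by (rule poly_mapping_eqI)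
        (use assms n_pos in \<open>auto simp: nf_exp_def lookup_add lookup_sum_single ones_def alpha_exp_def in_keys_iff subset_iff\<close>)
    moreover have "snd ?v = 0" by (simp add: nf_exp_def)
    ultimately show ?thesis by (simp add: prod_eq_iff)
  qed
  have "Poly_Mapping.single (u, 0) 1 - Poly_Mapping.single ?v (nf_coeff (u, 0)) =
      Poly_Mapping.single ?v 1 * (Poly_Mapping.single (ones ?c, 0) 1 - 1)"
    by (simp add: right_diff_distrib mult_single v nf_ones)
  moreover have "\<dots> \<in> I_laurent n l p \<zeta>"
    by (intro laurent.Idl_mult alpha_ones_minus_1 single_laurent supported_nf_exp)
  ultimately show ?thesis
    using assms by (simp add: normalizes_def supported_def)
qed

text \<open>
  Induction along the recursion: the generator of the ideal for \<open>(i, k)\<close> expresses the parameter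
  \<open>(i + 1, k)\<close> by a monomial that already normalizes.
\<close>

lemma normalizes_unit:
  assumes "i \<in> {1..n}" "k \<in> {1..l}"
  shows "normalizes (0, unit i k)"
  using assms(1)
proof (induction i)
  case (Suc i)
  show ?case
  proof (cases "i = 0")
    case True
    have "fst (nf_exp (0, unit 1 k)) = 0"
      using alpha_exp_unit[of 1 k] Suc.prems assms(2)
      by (simp add: nf_exp_def shift_sum_def)
    moreover have "snd (nf_exp (0, unit 1 k)) = unit 1 k"
    proof (rule poly_mapping_eqI)
      fix x :: "nat \<times> nat"
      show "Poly_Mapping.lookup (snd (nf_exp (0, unit 1 k))) x = Poly_Mapping.lookup (unit 1 k) x"
        using column_unit[of 1 k] assms(2) Suc.prems
        by (cases x) (auto simp: nf_exp_def lookup_sum lookup_single when_def)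
    qed
    moreover have "nf_coeff (0, unit 1 k) = 1"
      using zeta_exp_unit[of 1 k] Suc.prems assms(2) by (simp add: nf_coeff_def)
    ultimately have "nf_exp (0, unit 1 k) = (0, unit 1 k)" "nf_coeff (0, unit 1 k) = 1"
      by (simp_all add: prod_eq_iff)
    then show ?thesis
      using True laurent.Idl_0 supported_gens(4)[of 1 k] Suc.prems assms(2)
      by (simp add: normalizes_def)
  next
    case False
    then have i: "i \<in> {1..n}" "i mod n + 1 = Suc i" using Suc.prems by auto
    let ?v = "vec ((cyc ^^ (i - 1)) (p k))"
    let ?x = "(?v, unit i k)" and ?y = "(0, unit (Suc i) k)"
    let ?s = "Poly_Mapping.single"
    have "normalizes ((?v, 0) + (0, unit i k))"
      using Suc.IH[OF i(1)] supported_gens(3)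
      by (intro normalizes_add normalizes_alpha) (auto simp: supported_def)
    then have x: "?s ?x 1 - ?s (nf_exp ?x) (nf_coeff ?x) \<in> I_laurent n l p \<zeta>"
      by (simp add: normalizes_def)
    have gen: "?s ?x \<zeta> - ?s ?y 1 \<in> I_laurent n l p \<zeta>"
      using i assms(2) by (intro laurent.Idl_generator) (force simp: laurent_gens_def)
    have nf: "nf_exp ?y = nf_exp ?x" "nf_coeff ?y = \<zeta> * nf_coeff ?x"
      using nf_generator[OF i(1) assms(2)] by (simp_all only: i(2))
    have "?s ?y 1 - ?s (nf_exp ?y) (nf_coeff ?y) =
        ?s (0, 0) \<zeta> * (?s ?x 1 - ?s (nf_exp ?x) (nf_coeff ?x)) + - (?s ?x \<zeta> - ?s ?y 1)"
      unfolding nf by (simp add: right_diff_distrib mult_single flip: zero_prod_def)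
    also have "\<dots> \<in> I_laurent n l p \<zeta>"
      by (intro laurent.Idl_add laurent.Idl_mult laurent.Idl_uminus x gen single_laurent supported_gens)
    finally show ?thesis
      using supported_gens(4)[OF Suc.prems assms(2)] by (simp add: normalizes_def)
  qed
qed simp

lemma normalizes_supported:
  assumes "supported (u, e)"
  shows "normalizes (u, e)"
proof -
  have "normalizes (0, Poly_Mapping.single (i, k) m)" if "i \<in> {1..n}" "k \<in> {1..l}" for i k m
  proof (induction m)
    case 0 then show ?case using normalizes_0 by (simp add: zero_prod_def)
  next
    case (Suc m)
    then show ?case
      using normalizes_add[OF normalizes_unit[OF that] Suc] by (simp flip: single_add)
  qed
  then have "normalizes (0, exponent (Poly_Mapping.lookup e))"
    unfolding exponent_def by (intro normalizes_sum)
  then have "normalizes ((u, 0) + (0, e))"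
    using assms by (intro normalizes_add normalizes_alpha) (simp_all add: supported_def exponent_lookup)
  then show ?thesis by simp
qed

text \<open>
  Each term of \<open>f\<close> is congruent to its normal form, hence so is \<open>f\<close>.
\<close>

lemma kernel_subset_I_laurent:
  assumes "f \<in> carrier (laurent_ring n l)" "normal_form f = 0"
  shows "f \<in> I_laurent n l p \<zeta>"
proof -
  let ?s = "Poly_Mapping.single" and ?K = "Poly_Mapping.keys f"
  have "f = f - normal_form f" using assms(2) by simp
  also have "\<dots> = (\<Sum>x\<in>?K. ?s x (Poly_Mapping.lookup f x)) -
      (\<Sum>x\<in>?K. ?s (nf_exp x) (nf_coeff x * Poly_Mapping.lookup f x))"
    by (simp add: sum_monomials normal_form_def relabel_def)
  also have "\<dots> = (\<Sum>x\<in>?K. ?s (0, 0) (Poly_Mapping.lookup f x) * (?s x 1 - ?s (nf_exp x) (nf_coeff x)))"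
    by (simp add: right_diff_distrib mult_single sum_subtractf mult.commute flip: zero_prod_def)
  also have "\<dots> \<in> I_laurent n l p \<zeta>"
    using assms(1) normalizes_supported
    by (intro laurent.Idl_sum laurent.Idl_mult single_laurent supported_gens)
      (auto simp: carrier_laurent normalizes_def)
  finally show ?thesis .
qed

text \<open>
  Equal block sums make the difference \<open>d - e\<close> a difference \<open>shift u - u\<close>, where \<open>u\<close> is a block-wise
  antiderivative of \<open>e - d\<close>.  It is normalised by a large constant of integration, which contributes to
  each coordinate of \<open>L\<close> at least its own size, since the coordinate sums of the \<open>p k\<close> are positive.
\<close>

lemma cyclic_difference:
  assumes alpha_exp: "\<forall>j\<in>{1..n}. alpha_exp d j - alpha_exp e j = c"
    and col: "\<And>k. k \<in> {1..l} \<Longrightarrow> (\<Sum>i=1..n. e (i, k)) = (\<Sum>i=1..n. d (i, k))"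
  obtains u K where "exponent (shift u) + exponent e = exponent u + exponent d"
    and "\<forall>j\<in>{1..n}. L_coord u j = int K"
proof -
  (* total d keeps the truncated subtraction in u exact; the absolute value of c makes L nonnegative. *)
  define C where "C = nat \<bar>c\<bar> + total d"
  define u where "u = (\<lambda>(i, k). C + (\<Sum>j=1..i. e (j, k)) - (\<Sum>j=1..i. d (j, k)))"
  have le: "(\<Sum>j=1..i. d (j, k)) \<le> C" if "i \<le> n" "k \<in> {1..l}" for i k
  proof -
    have "(\<Sum>j=1..i. d (j, k)) \<le> (\<Sum>j=1..n. d (j, k))"
      using that by (intro sum_mono2) auto
    also have "\<dots> \<le> total d"
      unfolding total_def using that(2) by (intro member_le_sum) auto
    finally show ?thesis by (simp add: C_def)
  qed
  have un: "u (n, k) = C" if "k \<in> {1..l}" for k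
    using col[OF that] by (simp add: u_def)
  have diff: "shift u (i, k) + e (i, k) = u (i, k) + d (i, k)" if ik: "i \<in> {1..n}" "k \<in> {1..l}" for i k
  proof (cases "i = 1")
    case True
    then show ?thesis using un[OF that(2)] le[of 1 k] that by (simp add: shift_def u_def)
  next
    case False
    then obtain i' where "i = Suc i'" "0 < i'" using ik False by (cases i) auto
    then show ?thesis using le[of i' k] le[of i k] that by (simp add: shift_def u_def)
  qed
  have L_coord: "L_coord u j = c + int C * (\<Sum>k=1..l. sum_list (p k))" if "j \<in> {1..n}" for j
  proof -
    have "alpha_exp (shift u) j + alpha_exp e j = alpha_exp u j + alpha_exp d j"
      using stat_cong(3)[of "\<lambda>x. shift u x + e x" "\<lambda>x. u x + d x", OF diff]
      by (simp add: alpha_exp_add[symmetric])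
    moreover have "(\<Sum>k=1..l. int (u (n, k)) * sum_list (p k)) = int C * (\<Sum>k=1..l. sum_list (p k))"
      by (simp add: un sum_distrib_left)
    ultimately show ?thesis using alpha_exp_shift[OF that, of u] bspec[OF alpha_exp that] by linarith
  qed
  have "1 \<le> (\<Sum>k=1..l. 1 :: int)" using l_pos by simp
  also have "\<dots> \<le> (\<Sum>k=1..l. sum_list (p k))" by (intro sum_mono deg)
  finally have "int C * 1 \<le> int C * (\<Sum>k=1..l. sum_list (p k))" by (intro mult_left_mono) auto
  then have "0 \<le> c + int C * (\<Sum>k=1..l. sum_list (p k))" by (simp add: C_def)
  then have "\<forall>j\<in>{1..n}. L_coord u j = int (nat (c + int C * (\<Sum>k=1..l. sum_list (p k))))"
    using L_coord by simp
  moreover have "exponent (shift u) + exponent e = exponent u + exponent d"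
    unfolding exponent_add[symmetric] by (rule exponent_cong) (rule diff)
  ultimately show ?thesis using that by blast
qed

text \<open>
  With \<open>u\<close> as in \<open>cyclic_difference\<close>, the monomial of \<open>u\<close> times the binomial is, up to a scalar, the
  monomial of \<open>e\<close> times the generator of \<open>I_R\<close> belonging to \<open>u\<close>.  The scalars agree because \<open>nf_coeff\<close>
  is multiplicative.
\<close>

lemma binomial_in_saturation:
  assumes eq: "nf_exp (0, exponent e) = nf_exp (0, exponent d)"
  shows "Poly_Mapping.single (0, exponent e) (c * nf_coeff (0, exponent d)) -
    Poly_Mapping.single (0, exponent d) (c * nf_coeff (0, exponent e)) \<in> saturation n l (I_R n l p \<zeta>)"
proof -
  let ?s = "\<lambda>e. Poly_Mapping.single (0, e) :: complex \<Rightarrow> lpoly"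
  obtain c0 where c0: "\<forall>j\<in>{1..n}. alpha_exp d j - alpha_exp e j = c0"
    using nf_exp_eqD(1)[OF eq] by auto
  have "(\<Sum>i=1..n. e (i, k)) = (\<Sum>i=1..n. d (i, k))" if "k \<in> {1..l}" for k
    using nf_exp_eqD(2)[OF eq that] that by (simp add: lookup_exponent)
  from cyclic_difference[OF c0 this] obtain u K
    where u: "exponent (shift u) + exponent e = exponent u + exponent d"
      and K: "\<forall>j\<in>{1..n}. L_coord u j = int K" by blast
  (* Any bound on the entries of u will do: the r-th power of par_prod is then divisible by the monomial of u. *)
  define r where "r = total u"
  have "u (i, k) \<le> r" if "i \<in> {1..n}" "k \<in> {1..l}" for i k
  proof -
    have "u (i, k) \<le> (\<Sum>i=1..n. u (i, k))" using that by (intro member_le_sum) auto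
    also have "\<dots> \<le> r" unfolding r_def total_def using that
      by (intro member_le_sum[where f = "\<lambda>k. \<Sum>i=1..n. u (i, k)"]) auto
    finally show ?thesis .
  qed
  then have r: "exponent (\<lambda>_. r) = exponent (\<lambda>x. r - u x) + exponent u"
    unfolding exponent_add[symmetric] by (intro exponent_cong) simp
  have coeff: "\<zeta> ^ total u * nf_coeff (0, exponent e) = nf_coeff (0, exponent d)"
  proof -
    have "nf_coeff ((0, exponent (shift u)) + (0, exponent e)) = nf_coeff ((0, exponent u) + (0, exponent d))"
      using u by simp
    then show ?thesis
      unfolding nf_coeff_add nf_shift(2)[OF K] using nf_coeff_nonzero[of "(0, exponent u)"] by auto
  qed
  let ?g = "?s (exponent u) (\<zeta> ^ total u) - ?s (exponent (shift u)) 1"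
  have "?s (exponent (\<lambda>x. r - u x)) 1 * (?s (exponent e) (c * nf_coeff (0, exponent e)) * ?g) \<in> I_R n l p \<zeta>"
    using K by (intro param.Idl_mult param.Idl_generator single_param) (auto simp: I_R_gens_def)
  also have "?s (exponent (\<lambda>x. r - u x)) 1 * (?s (exponent e) (c * nf_coeff (0, exponent e)) * ?g) =
      ?s (exponent (\<lambda>x. r - u x)) 1 *
        (?s (exponent u + exponent e) (c * nf_coeff (0, exponent d)) - ?s (exponent u + exponent d) (c * nf_coeff (0, exponent e)))"
    using u by (simp add: right_diff_distrib mult_single coeff[symmetric] add.commute mult_ac)
  also have "\<dots> = par_prod n l ^ r *
      (?s (exponent e) (c * nf_coeff (0, exponent d)) - ?s (exponent d) (c * nf_coeff (0, exponent e)))"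
    by (simp add: par_prod_power r right_diff_distrib mult_single add.assoc)
  finally show ?thesis
    by (auto simp: saturation_def intro!: carrier_param_diff single_param)
qed

lemma saturation_add:
  assumes "f \<in> saturation n l (I_R n l p \<zeta>)" "g \<in> saturation n l (I_R n l p \<zeta>)"
  shows "f + g \<in> saturation n l (I_R n l p \<zeta>)"
proof -
  obtain r s where fg: "par_prod n l ^ r * f \<in> I_R n l p \<zeta>" "par_prod n l ^ s * g \<in> I_R n l p \<zeta>"
    and car: "f \<in> carrier (param_ring n l)" "g \<in> carrier (param_ring n l)"
    using assms by (auto simp: saturation_def)
  have "par_prod n l ^ (r + s) * (f + g) =
      par_prod n l ^ s * (par_prod n l ^ r * f) + par_prod n l ^ r * (par_prod n l ^ s * g)"
    by (simp add: power_add distrib_left distrib_right mult_ac)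
  also have "\<dots> \<in> I_R n l p \<zeta>"
    by (intro param.Idl_add param.Idl_mult fg) (simp_all add: par_prod_power single_param)
  finally show ?thesis
    using param.carrier_closed(3)[OF car] by (auto simp: saturation_def)
qed

lemma kernel_subset_saturation:
  assumes f: "f \<in> carrier (param_ring n l)" and ker: "normal_form f = 0"
  shows "f \<in> saturation n l (I_R n l p \<zeta>)"
proof (rule relabel_kernel_binomials[OF ker[unfolded normal_form_def] nf_coeff_nonzero])
  show "0 \<in> saturation n l (I_R n l p \<zeta>)"
    using param.Idl_0 param.carrier_closed(1) by (simp add: saturation_def)
next
  fix x y c
  assume xy: "x \<in> Poly_Mapping.keys f" "y \<in> Poly_Mapping.keys f" and eq: "nf_exp x = nf_exp y"
  have "\<exists>g. x = (0, exponent g)" if "x \<in> Poly_Mapping.keys f" for x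
    using f that exponent_lookup[of "snd x"]
    by (intro exI[of _ "Poly_Mapping.lookup (snd x)"]) (auto simp: carrier_param supported_def prod_eq_iff)
  with xy obtain e d where "x = (0, exponent e)" "y = (0, exponent d)" by blast
  with binomial_in_saturation eq
  show "Poly_Mapping.single x (c * nf_coeff y) - Poly_Mapping.single y (c * nf_coeff x)
      \<in> saturation n l (I_R n l p \<zeta>)" by simp
qed (rule saturation_add)

lemma saturation_eq_I_zeta: "saturation n l (I_R n l p \<zeta>) = I_zeta n l p \<zeta>"
proof
  show "saturation n l (I_R n l p \<zeta>) \<subseteq> I_zeta n l p \<zeta>"
  proof
    fix f assume f: "f \<in> saturation n l (I_R n l p \<zeta>)"
    then have car: "f \<in> carrier (param_ring n l)" by (simp add: saturation_def)
    moreover have "f \<in> I_laurent n l p \<zeta>"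
      using car normal_form_saturation[OF f]
      by (intro kernel_subset_I_laurent) (auto simp: carrier_param carrier_laurent)
    ultimately show "f \<in> I_zeta n l p \<zeta>" by (simp add: I_zeta_def)
  qed
  show "I_zeta n l p \<zeta> \<subseteq> saturation n l (I_R n l p \<zeta>)"
    using kernel_subset_saturation normal_form_I_laurent by (auto simp: I_zeta_def)
qed

end

theorem theorem4p20:
  fixes n l :: nat and p :: "nat \<Rightarrow> int list" and \<zeta> :: complex
  assumes "prime n" and "n > 2"
    and "primitive_root_of_unity n \<zeta>"
    and "admissible n l p"
  shows "saturation n l (I_R n l p \<zeta>) = I_zeta n l p \<zeta>"
proof -
  interpret cyclic_family n l p \<zeta>
    using assms by unfold_locales (auto simp: primitive_root_of_unity_def admissible_def)
  show ?thesis by (rule saturation_eq_I_zeta)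
qed

end
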